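(* Let $G$ be any partially ordered group and $\mathsf{V}$ any variety of $\ell$-groups. The maps $\kappa\colon \mathscr{P}_{\mathsf V}(G)\to \mathrm{Spec}\,F_{\mathsf V}(G)$ and $\pi\colon \mathrm{Spec}\,F_{\mathsf V}(G)\to \mathscr{P}_{\mathsf V}(G)$ defined in the context are mutually inverse, inclusion-preserving homeomorphisms, and they restrict to homeomorphisms between $\mathscr{B}_{\mathsf V}(G)$ and $\mathrm{Spec}^*F_{\mathsf V}(G)$. (Part of the assertion is that $\pi$ is well defined, i.e. takes values in $\mathscr{P}_{\mathsf V}(G)$.)
   Context: A partially ordered group is a group $G$ (identity $\mathrm{e}$) with a partial order such that $a\le b$ implies $sat\le sbt$ for all $a,b,s,t$; $G^+=\{a\in G\mid a\ge \mathrm{e}\}$. An $\ell$-group is a partially ordered group whose order is a lattice; $\ell$-homomorphisms are group homomorphisms that are lattice homomorphisms; an $\ell$-subgroup is a sublattice subgroup; a variety of $\ell$-groups is an equationally definable class of $\ell$-groups. A positive homomorphism is an order-preserving group homomorphism. Right pre-orders. A right pre-order on $G$ is a reflexive, transitive, total relation $\preceq$ on $G$, with $\preceq\ne G\times G$, that extends the partial order of $G$ and satisfies $a\preceq b\Rightarrow at\preceq bt$. It is identified with its pre-cone $C=\{a\mid \mathrm{e}\preceq a\}$; pre-cones are exactly the proper submonoids $C\subsetneq G$ with $G=C\cup C^{-1}$ and $G^+\subseteq C$, and $a\preceq_C b$ iff $ba^{-1}\in C$. It is a pre-order on $G$ if it is also left invariant, equivalently if $C$ is normal (closed under conjugation).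 Given $C$, put $a\equiv_C b$ iff $a\preceq_C b$ and $b\preceq_C a$; $\Omega_C=G/{\equiv_C}$ is a chain with $[a]\le_C[b]$ iff $a\preceq_C b$. $\mathrm{Aut}\,\Omega_C$ is the $\ell$-group of order-preserving bijections of $\Omega_C$, where $f\cdot g$ means "$g$ after $f$" and the lattice operations are pointwise. Let $R_C(a)\colon [b]\mapsto[ba]$; $R_C$ is a positive homomorphism from $G$, and $H_C$ is the $\ell$-subgroup of $\mathrm{Aut}\,\Omega_C$ generated by $R_C[G]$. $\mathscr{P}_{\mathsf V}(G)$ is the set of right pre-orders (pre-cones) $C$ on $G$ with $H_C\in\mathsf V$, and $\mathscr{B}_{\mathsf V}(G)$ is its subset of pre-orders. Both are ordered by inclusion of pre-cones. $\mathscr{P}_{\mathsf V}(G)$ has the smallest topology containing all sets $\mathbb{P}(a)=\{C\in\mathscr{P}_{\mathsf V}(G)\mid a\in C,\ a^{-1}\notin C\}$, $a\in G$; $\mathscr{B}_{\mathsf V}(G)$ has the subspace topology. Free objects. $F_{\mathsf V}(G)$, with positive homomorphism $\eta\colon G\to F_{\mathsf V}(G)$, is the free $\ell$-group over $G$ in $\mathsf V$: $F_{\mathsf V}(G)\in\mathsf V$ and for each positive homomorphism $p\colon G\to H$ with $H\in\mathsf V$ there is exactly one $\ell$-homomorphism $h\colon F_{\mathsf V}(G)\to H$ with $h\circ\eta=p$. Spectra. For an $\ell$-group $H$, a convex $\ell$-subgroup is an order-convex sublattice subgroup $\mathfrak k$; the cosets $\mathfrak kx$ are lattice-ordered by $\mathfrak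 kx\le\mathfrak ky$ iff $x\le ty$ for some $t\in\mathfrak k$. It is prime if it is proper and $H/\mathfrak k$ is totally ordered. An ideal is a normal convex $\ell$-subgroup. $\mathrm{Spec}\,H$ is the set of prime (convex $\ell$-)subgroups, ordered by inclusion, with open sets $\mathbb S(A)=\{\mathfrak p\in \mathrm{Spec}\,H\mid A\not\subseteq\mathfrak p\}$, $A\subseteq H$; $\mathrm{Spec}^*H$ is the subspace of prime ideals. The maps. For $C\in\mathscr{P}_{\mathsf V}(G)$ let $h_C\colon F_{\mathsf V}(G)\to H_C$ be the unique $\ell$-homomorphism with $h_C\circ\eta=R_C$, and set $\kappa(C)=h_C^{-1}(\{f\in H_C\mid f([\mathrm{e}])=[\mathrm{e}]\})$, which is a prime subgroup. For $\mathfrak p\in\mathrm{Spec}\,F_{\mathsf V}(G)$ let $\pi(\mathfrak p)$ be the (pre-cone of the) relation $a\preceq_{\mathfrak p}b$ iff $\mathfrak p\,\eta(a)\le\mathfrak p\,\eta(b)$. *)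

theory Defs
  imports
    "HOL-Algebra.Coset"
    "HOL-Algebra.Bij"
    "HOL-Algebra.Lattice"
    "HOL-Analysis.Abstract_Topology"
begin
record 'a ogroup = "'a monoid" +
  ole :: "'a \<Rightarrow> 'a \<Rightarrow> bool" (infixl \<open>\<preceq>\<index>\<close> 50)

definition order_of :: "('a, 'm) ogroup_scheme \<Rightarrow> 'a gorder" where
  "order_of G = \<lparr>carrier = carrier G, eq = (=), le = (\<preceq>\<^bsub>G\<^esub>)\<rparr>"

locale po_group = group G for G :: "('a, 'm) ogroup_scheme" (structure) +
  assumes po: "partial_order (order_of G)"
    and mult_mono: "\<lbrakk>a \<in> carrier G; b \<in> carrier G; s \<in> carrier G; t \<in> carrier G; a \<preceq> b\<rbrakk>
      \<Longrightarrow> s \<otimes> a \<otimes> t \<preceq> s \<otimes> b \<otimes> t"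

locale l_group = po_group +
  assumes lat: "lattice (order_of G)"

abbreviation ojoin :: "('a, 'm) ogroup_scheme \<Rightarrow> 'a \<Rightarrow> 'a \<Rightarrow> 'a" where
  "ojoin G x y \<equiv> x \<squnion>\<^bsub>order_of G\<^esub> y"

abbreviation omeet :: "('a, 'm) ogroup_scheme \<Rightarrow> 'a \<Rightarrow> 'a \<Rightarrow> 'a" where
  "omeet G x y \<equiv> x \<sqinter>\<^bsub>order_of G\<^esub> y"

definition positive_hom ::
  "('a, 'm) ogroup_scheme \<Rightarrow> ('b, 'n) ogroup_scheme \<Rightarrow> ('a \<Rightarrow> 'b) \<Rightarrow> bool" where
  "positive_hom G H p \<longleftrightarrow> p \<in> hom G H \<and>
     (\<forall>a\<in>carrier G. \<forall>b\<in>carrier G. a \<preceq>\<^bsub>G\<^esub> b \<longrightarrow> p a \<preceq>\<^bsub>H\<^esub> p b)"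

definition l_hom ::
  "('a, 'm) ogroup_scheme \<Rightarrow> ('b, 'n) ogroup_scheme \<Rightarrow> ('a \<Rightarrow> 'b) \<Rightarrow> bool" where
  "l_hom G H h \<longleftrightarrow> h \<in> hom G H \<and>
     (\<forall>x\<in>carrier G. \<forall>y\<in>carrier G.
        h (ojoin G x y) = ojoin H (h x) (h y) \<and> h (omeet G x y) = omeet H (h x) (h y))"

definition l_subgroup :: "'a set \<Rightarrow> ('a, 'm) ogroup_scheme \<Rightarrow> bool" where
  "l_subgroup K H \<longleftrightarrow> subgroup K H \<and> (\<forall>x\<in>K. \<forall>y\<in>K. ojoin H x y \<in> K \<and> omeet H x y \<in> K)"

definition l_generated :: "('a, 'm) ogroup_scheme \<Rightarrow> 'a set \<Rightarrow> 'a set" where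
  "l_generated H A = \<Inter>{K. l_subgroup K H \<and> A \<subseteq> K}"

text \<open>
  A variety is given by a set of defining equations between terms in the language of
  lattice-ordered groups. Every equation involves finitely many variables, so variables
  may be taken to be natural numbers. Presenting a variety by its equations allows
  membership to be tested for groups on any type.
\<close>

datatype lterm =
    Var nat
  | Unit
  | Inv lterm
  | Mult lterm lterm
  | Join lterm lterm
  | Meet lterm lterm

primrec leval :: "('a, 'm) ogroup_scheme \<Rightarrow> (nat \<Rightarrow> 'a) \<Rightarrow> lterm \<Rightarrow> 'a" where
  "leval H v (Var n) = v n"
| "leval H v Unit = \<one>\<^bsub>H\<^esub>"
| "leval H v (Inv s) = inv\<^bsub>H\<^esub> (leval H v s)"
| "leval H v (Mult s t) = leval H v s \<otimes>\<^bsub>H\<^esub> leval H v t"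
| "leval H v (Join s t) = ojoin H (leval H v s) (leval H v t)"
| "leval H v (Meet s t) = omeet H (leval H v s) (leval H v t)"

type_synonym variety = "(lterm \<times> lterm) set"

definition in_variety :: "variety \<Rightarrow> ('a, 'm) ogroup_scheme \<Rightarrow> bool" where
  "in_variety V H \<longleftrightarrow> l_group H \<and>
     (\<forall>(s, t)\<in>V. \<forall>v. (\<forall>n. v n \<in> carrier H) \<longrightarrow> leval H v s = leval H v t)"

text \<open>
  A formula cannot quantify over types, so the universal property is relative to the
  type \<open>'h\<close> of the test objects; the free object in the usual sense has it for every
  \<open>'h\<close>. Assuming it only for particular types is the weaker hypothesis. Maps on carriers
  are represented by extensional functions, for which \<open>\<exists>!\<close> is uniqueness on the carrier.
\<close>

definition universal_in ::
  "'h itself \<Rightarrow> variety \<Rightarrow> 'g ogroup \<Rightarrow> 'f ogroup \<Rightarrow> ('g \<Rightarrow> 'f) \<Rightarrow> bool" where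
  "universal_in T V G F \<eta> \<longleftrightarrow>
     (\<forall>(H :: 'h ogroup) p. in_variety V H \<and> positive_hom G H p \<longrightarrow>
        (\<exists>!h. h \<in> extensional (carrier F) \<and> l_hom F H h \<and> (\<forall>a\<in>carrier G. h (\<eta> a) = p a)))"

definition free_l_group ::
  "'h itself \<Rightarrow> variety \<Rightarrow> 'g ogroup \<Rightarrow> 'f ogroup \<Rightarrow> ('g \<Rightarrow> 'f) \<Rightarrow> bool" where
  "free_l_group T V G F \<eta> \<longleftrightarrow>
     in_variety V F \<and> positive_hom G F \<eta> \<and> universal_in T V G F \<eta>"

definition right_preorder :: "('g, 'm) ogroup_scheme \<Rightarrow> 'g rel \<Rightarrow> bool" where
  "right_preorder G R \<longleftrightarrow>
     R \<subseteq> carrier G \<times> carrier G \<and> refl_on (carrier G) R \<and> trans R \<and> total_on (carrier G) R \<and>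
     R \<noteq> carrier G \<times> carrier G \<and>
     (\<forall>a\<in>carrier G. \<forall>b\<in>carrier G. a \<preceq>\<^bsub>G\<^esub> b \<longrightarrow> (a, b) \<in> R) \<and>
     (\<forall>t\<in>carrier G. \<forall>(a, b)\<in>R. (a \<otimes>\<^bsub>G\<^esub> t, b \<otimes>\<^bsub>G\<^esub> t) \<in> R)"

definition cone_of :: "('g, 'm) ogroup_scheme \<Rightarrow> 'g rel \<Rightarrow> 'g set" where
  "cone_of G R = {a \<in> carrier G. (\<one>\<^bsub>G\<^esub>, a) \<in> R}"

definition preorder_of :: "('g, 'm) ogroup_scheme \<Rightarrow> 'g set \<Rightarrow> 'g rel" where
  "preorder_of G C = {(a, b). a \<in> carrier G \<and> b \<in> carrier G \<and> b \<otimes>\<^bsub>G\<^esub> inv\<^bsub>G\<^esub> a \<in> C}"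

definition precone :: "('g, 'm) ogroup_scheme \<Rightarrow> 'g set \<Rightarrow> bool" where
  "precone G C \<longleftrightarrow> (\<exists>R. right_preorder G R \<and> C = cone_of G R)"

lemma (in po_group) preorder_of_cone_of:
  assumes "right_preorder G R"
  shows "preorder_of G (cone_of G R) = R"
proof -
  have sub: "R \<subseteq> carrier G \<times> carrier G"
    and inv: "\<And>a b t. (a, b) \<in> R \<Longrightarrow> t \<in> carrier G \<Longrightarrow> (a \<otimes> t, b \<otimes> t) \<in> R"
    using assms unfolding right_preorder_def by blast+
  have "(\<one>, b \<otimes> inv a) \<in> R \<longleftrightarrow> (a, b) \<in> R" if "a \<in> carrier G" "b \<in> carrier G" for a b
    using inv[of \<one> "b \<otimes> inv a" a] inv[of a b "inv a"] that by (auto simp: m_assoc)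
  then show ?thesis
    using sub unfolding preorder_of_def cone_of_def by auto
qed

lemma (in po_group) precone_iff:
  "precone G C \<longleftrightarrow> submonoid C G \<and> C \<noteq> carrier G \<and>
     carrier G = C \<union> m_inv G ` C \<and> {a \<in> carrier G. \<one> \<preceq> a} \<subseteq> C"
proof
  assume "precone G C"
  then obtain R where R: "right_preorder G R" and C: "C = cone_of G R"
    unfolding precone_def by blast
  have eq: "(a, b) \<in> R \<longleftrightarrow> a \<in> carrier G \<and> b \<in> carrier G \<and> b \<otimes> inv a \<in> C" for a b
    using preorder_of_cone_of[OF R] C unfolding preorder_of_def by blast
  have rel: "refl_on (carrier G) R" "trans R" "total_on (carrier G) R"
    "R \<noteq> carrier G \<times> carrier G"
    "\<And>a b. a \<in> carrier G \<Longrightarrow> b \<in> carrier G \<Longrightarrow> a \<preceq> b \<Longrightarrow> (a, b) \<in> R"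
    "\<And>a b t. (a, b) \<in> R \<Longrightarrow> t \<in> carrier G \<Longrightarrow> (a \<otimes> t, b \<otimes> t) \<in> R"
    using R unfolding right_preorder_def by blast+
  have CG: "C \<subseteq> carrier G" using C by (auto simp: cone_of_def)
  have mem: "a \<in> C \<longleftrightarrow> a \<in> carrier G \<and> (\<one>, a) \<in> R" for a using C by (auto simp: cone_of_def)
  have tot: "a \<in> C \<or> inv a \<in> C" if "a \<in> carrier G" for a
    using rel(1,3) eq[of a \<one>] mem[of a] that unfolding total_on_def refl_on_def
    by (metis inv_closed l_one one_closed)
  have "submonoid C G"
  proof
    fix x y assume "x \<in> C" "y \<in> C"
    then have "(y, x \<otimes> y) \<in> R" "(\<one>, y) \<in> R" using rel(6)[of \<one> x y] mem by auto
    then show "x \<otimes> y \<in> C" using rel(2) mem \<open>x \<in> C\<close> \<open>y \<in> C\<close> by (meson transD m_closed)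
  qed (use CG mem rel(1) in \<open>auto simp: refl_on_def\<close>)
  moreover have "C \<noteq> carrier G"
    using rel(4) eq by auto
  moreover have "carrier G = C \<union> m_inv G ` C"
    using tot CG by (force simp: image_iff)
  moreover have "{a \<in> carrier G. \<one> \<preceq> a} \<subseteq> C" using rel(5) mem by auto
  ultimately show "submonoid C G \<and> C \<noteq> carrier G \<and>
     carrier G = C \<union> m_inv G ` C \<and> {a \<in> carrier G. \<one> \<preceq> a} \<subseteq> C" by blast
next
  assume "submonoid C G \<and> C \<noteq> carrier G \<and>
     carrier G = C \<union> m_inv G ` C \<and> {a \<in> carrier G. \<one> \<preceq> a} \<subseteq> C"
  then have sm: "submonoid C G" and ne: "C \<noteq> carrier G"
    and cov: "carrier G = C \<union> m_inv G ` C"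
    and pos: "\<And>a. a \<in> carrier G \<Longrightarrow> \<one> \<preceq> a \<Longrightarrow> a \<in> C" by blast+
  interpret C: submonoid C G by (rule sm)
  let ?R = "preorder_of G C"
  have tot: "a \<in> C \<or> inv a \<in> C" if "a \<in> carrier G" for a
  proof -
    have "a \<in> C \<union> m_inv G ` C" using cov that by simp
    then show ?thesis using C.subset by auto
  qed
  have "right_preorder G ?R"
    unfolding right_preorder_def
  proof (intro conjI)
    show "?R \<subseteq> carrier G \<times> carrier G" "refl_on (carrier G) ?R"
      by (auto simp: preorder_of_def refl_on_def)
    show "trans ?R"
    proof (rule transI)
      fix x y z assume "(x, y) \<in> ?R" "(y, z) \<in> ?R"
      then have c: "x \<in> carrier G" "y \<in> carrier G" "z \<in> carrier G"
        and "(z \<otimes> inv y) \<otimes> (y \<otimes> inv x) \<in> C"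
        by (auto simp: preorder_of_def)
      moreover have "(z \<otimes> inv y) \<otimes> (y \<otimes> inv x) = z \<otimes> (inv y \<otimes> y) \<otimes> inv x"
        using c by (simp only: m_assoc m_closed inv_closed)
      ultimately show "(x, z) \<in> ?R" using c by (simp add: preorder_of_def)
    qed
    show "total_on (carrier G) ?R"
    proof (rule total_onI)
      fix x y assume c: "x \<in> carrier G" "y \<in> carrier G"
      then show "(x, y) \<in> ?R \<or> (y, x) \<in> ?R"
        using tot[of "y \<otimes> inv x"] by (simp add: preorder_of_def inv_mult_group)
    qed
    show "?R \<noteq> carrier G \<times> carrier G"
    proof
      assume e: "?R = carrier G \<times> carrier G"
      have "a \<in> C" if "a \<in> carrier G" for a
      proof -
        have "(\<one>, a) \<in> ?R" using that e by blast
        then show ?thesis using that by (simp add: preorder_of_def)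
      qed
      with ne C.subset show False by blast
    qed
    show "\<forall>a\<in>carrier G. \<forall>b\<in>carrier G. a \<preceq> b \<longrightarrow> (a, b) \<in> ?R"
    proof (intro ballI impI)
      fix a b assume c: "a \<in> carrier G" "b \<in> carrier G" "a \<preceq> b"
      have "\<one> \<preceq> b \<otimes> inv a" using mult_mono[of a b \<one> "inv a"] c by simp
      then show "(a, b) \<in> ?R" using pos c by (simp add: preorder_of_def)
    qed
    show "\<forall>t\<in>carrier G. \<forall>(a, b)\<in>?R. (a \<otimes> t, b \<otimes> t) \<in> ?R"
    proof (clarify)
      fix t a b assume t: "t \<in> carrier G" and "(a, b) \<in> ?R"
      then have c: "a \<in> carrier G" "b \<in> carrier G" "b \<otimes> inv a \<in> C"
        by (auto simp: preorder_of_def)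
      have "b \<otimes> t \<otimes> inv (a \<otimes> t) = b \<otimes> (t \<otimes> inv t) \<otimes> inv a"
        using c t by (simp only: inv_mult_group m_assoc m_closed inv_closed)
      then show "(a \<otimes> t, b \<otimes> t) \<in> ?R" using c t by (simp add: preorder_of_def)
    qed
  qed
  moreover have "C = cone_of G ?R"
    using C.subset by (auto simp: cone_of_def preorder_of_def)
  ultimately show "precone G C" unfolding precone_def by blast
qed

definition equiv_of :: "('g, 'm) ogroup_scheme \<Rightarrow> 'g set \<Rightarrow> 'g rel" where
  "equiv_of G C = {(a, b). (a, b) \<in> preorder_of G C \<and> (b, a) \<in> preorder_of G C}"

definition Omega :: "('g, 'm) ogroup_scheme \<Rightarrow> 'g set \<Rightarrow> 'g set set" where
  "Omega G C = carrier G // equiv_of G C"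

definition Omega_le :: "('g, 'm) ogroup_scheme \<Rightarrow> 'g set \<Rightarrow> 'g set \<Rightarrow> 'g set \<Rightarrow> bool" where
  "Omega_le G C X Y \<longleftrightarrow>
     (\<exists>a\<in>carrier G. \<exists>b\<in>carrier G. X = equiv_of G C `` {a} \<and> Y = equiv_of G C `` {b} \<and>
        (a, b) \<in> preorder_of G C)"

text \<open>
  The product of \<open>f\<close> and \<open>g\<close> is \<open>g\<close> after \<open>f\<close>. Only the pointwise
  order is recorded; on a chain its joins and meets are the pointwise ones.
\<close>

definition Aut_chain :: "'x set \<Rightarrow> ('x \<Rightarrow> 'x \<Rightarrow> bool) \<Rightarrow> ('x \<Rightarrow> 'x) ogroup" where
  "Aut_chain S r =
     \<lparr>carrier = {f \<in> Bij S. \<forall>x\<in>S. \<forall>y\<in>S. r x y \<longrightarrow> r (f x) (f y)},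
      mult = (\<lambda>f g. compose S g f),
      one = (\<lambda>x\<in>S. x),
      ole = (\<lambda>f g. \<forall>x\<in>S. r (f x) (g x))\<rparr>"

definition Aut_Omega :: "('g, 'm) ogroup_scheme \<Rightarrow> 'g set \<Rightarrow> ('g set \<Rightarrow> 'g set) ogroup" where
  "Aut_Omega G C = Aut_chain (Omega G C) (Omega_le G C)"

text \<open>The union ranges over the representatives of \<open>X\<close>, all of which give the same class.\<close>

definition R_map :: "('g, 'm) ogroup_scheme \<Rightarrow> 'g set \<Rightarrow> 'g \<Rightarrow> 'g set \<Rightarrow> 'g set" where
  "R_map G C a = (\<lambda>X\<in>Omega G C. \<Union>b\<in>X. equiv_of G C `` {b \<otimes>\<^bsub>G\<^esub> a})"

definition H_of :: "('g, 'm) ogroup_scheme \<Rightarrow> 'g set \<Rightarrow> ('g set \<Rightarrow> 'g set) ogroup" where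
  "H_of G C = (Aut_Omega G C)
     \<lparr>carrier := l_generated (Aut_Omega G C) (R_map G C ` carrier G)\<rparr>"

definition PV :: "variety \<Rightarrow> ('g, 'm) ogroup_scheme \<Rightarrow> 'g set set" where
  "PV V G = {C. precone G C \<and> in_variety V (H_of G C)}"

definition BV :: "variety \<Rightarrow> ('g, 'm) ogroup_scheme \<Rightarrow> 'g set set" where
  "BV V G = {C \<in> PV V G. \<forall>t\<in>carrier G. \<forall>(a, b)\<in>preorder_of G C.
     (t \<otimes>\<^bsub>G\<^esub> a, t \<otimes>\<^bsub>G\<^esub> b) \<in> preorder_of G C}"

definition PP :: "variety \<Rightarrow> ('g, 'm) ogroup_scheme \<Rightarrow> 'g \<Rightarrow> 'g set set" where
  "PP V G a = {C \<in> PV V G. a \<in> C \<and> inv\<^bsub>G\<^esub> a \<notin> C}"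

definition PV_topology :: "variety \<Rightarrow> ('g, 'm) ogroup_scheme \<Rightarrow> 'g set topology" where
  "PV_topology V G = topology_generated_by (insert (PV V G) (PP V G ` carrier G))"

definition BV_topology :: "variety \<Rightarrow> ('g, 'm) ogroup_scheme \<Rightarrow> 'g set topology" where
  "BV_topology V G = subtopology (PV_topology V G) (BV V G)"

definition convex_l_subgroup :: "'a set \<Rightarrow> ('a, 'm) ogroup_scheme \<Rightarrow> bool" where
  "convex_l_subgroup K H \<longleftrightarrow> l_subgroup K H \<and>
     (\<forall>x\<in>K. \<forall>z\<in>K. \<forall>y\<in>carrier H. x \<preceq>\<^bsub>H\<^esub> y \<and> y \<preceq>\<^bsub>H\<^esub> z \<longrightarrow> y \<in> K)"

definition coset_le :: "('a, 'm) ogroup_scheme \<Rightarrow> 'a set \<Rightarrow> 'a set \<Rightarrow> 'a set \<Rightarrow> bool" where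
  "coset_le H K X Y \<longleftrightarrow>
     (\<exists>x\<in>carrier H. \<exists>y\<in>carrier H. X = K #>\<^bsub>H\<^esub> x \<and> Y = K #>\<^bsub>H\<^esub> y \<and>
        (\<exists>t\<in>K. x \<preceq>\<^bsub>H\<^esub> t \<otimes>\<^bsub>H\<^esub> y))"

definition prime_subgroup :: "'a set \<Rightarrow> ('a, 'm) ogroup_scheme \<Rightarrow> bool" where
  "prime_subgroup K H \<longleftrightarrow> convex_l_subgroup K H \<and> K \<noteq> carrier H \<and>
     (\<forall>X\<in>rcosets\<^bsub>H\<^esub> K. \<forall>Y\<in>rcosets\<^bsub>H\<^esub> K. coset_le H K X Y \<or> coset_le H K Y X)"

definition Spec :: "('a, 'm) ogroup_scheme \<Rightarrow> 'a set set" where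
  "Spec H = {K. prime_subgroup K H}"

definition Spec_star :: "('a, 'm) ogroup_scheme \<Rightarrow> 'a set set" where
  "Spec_star H = {K \<in> Spec H. K \<lhd> H}"

definition SS :: "('a, 'm) ogroup_scheme \<Rightarrow> 'a set \<Rightarrow> 'a set set" where
  "SS H A = {K \<in> Spec H. \<not> A \<subseteq> K}"

definition Spec_topology :: "('a, 'm) ogroup_scheme \<Rightarrow> 'a set topology" where
  "Spec_topology H = topology (\<lambda>U. \<exists>A\<subseteq>carrier H. U = SS H A)"

text \<open>
  \<open>topology\<close> is meaningful only for families satisfying \<open>istopology\<close>; lemma
  \<open>openin_Spec_topology\<close> below shows that this one does.
\<close>

lemma (in l_group) prime_inter_char:
  assumes K: "prime_subgroup K G" and A: "A \<subseteq> carrier G" and B: "B \<subseteq> carrier G"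
  shows "(\<not> A \<subseteq> K \<and> \<not> B \<subseteq> K) \<longleftrightarrow>
    \<not> {omeet G (ojoin G a \<one>) (ojoin G b \<one>) | a b. a \<in> A \<union> m_inv G ` A \<and> b \<in> B \<union> m_inv G ` B} \<subseteq> K"
proof -
  interpret L: lattice "order_of G" by (rule lat)
  have [simp]: "carrier (order_of G) = carrier G" "(\<sqsubseteq>\<^bsub>order_of G\<^esub>) = (\<preceq>)"
    by (simp_all add: order_of_def)
  note cl = L.join_closed[simplified] L.meet_closed[simplified]
  note jl = L.join_left[simplified] and jr = L.join_right[simplified]
  note ml = L.meet_left[simplified] and mr = L.meet_right[simplified]
  note mle = L.meet_le[simplified]
  note tr = L.le_trans[simplified]
  have S: "subgroup K G"
    and lk: "\<And>x y. x \<in> K \<Longrightarrow> y \<in> K \<Longrightarrow> ojoin G x y \<in> K \<and> omeet G x y \<in> K"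
    and conv: "\<And>x y z. x \<in> K \<Longrightarrow> z \<in> K \<Longrightarrow> y \<in> carrier G \<Longrightarrow> x \<preceq> y \<Longrightarrow> y \<preceq> z \<Longrightarrow> y \<in> K"
    and tot: "\<And>X Y. X \<in> rcosets K \<Longrightarrow> Y \<in> rcosets K \<Longrightarrow> coset_le G K X Y \<or> coset_le G K Y X"
    using K unfolding prime_subgroup_def convex_l_subgroup_def l_subgroup_def by blast+
  interpret S: subgroup K G by (rule S)
  have one: "\<one> \<in> K" by simp
  have pos: "ojoin G a \<one> \<in> carrier G \<and> \<one> \<preceq> ojoin G a \<one>" if "a \<in> carrier G" for a
    using that cl jr by simp
  have lm: "s \<otimes> a \<preceq> s \<otimes> b" if "a \<preceq> b" "s \<in> carrier G" "a \<in> carrier G" "b \<in> carrier G" for s a b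
    using mult_mono[of a b s \<one>] that by simp
  have rm: "a \<otimes> s \<preceq> b \<otimes> s" if "a \<preceq> b" "s \<in> carrier G" "a \<in> carrier G" "b \<in> carrier G" for s a b
    using mult_mono[of a b \<one> s] that by simp
  have key: "u \<in> K" if u: "u \<in> carrier G" "\<one> \<preceq> u" and v: "v \<in> carrier G"
    and m: "omeet G u v \<in> K" and c: "coset_le G K (K #> u) (K #> v)" for u v
  proof -
    obtain x y t where xy: "x \<in> carrier G" "y \<in> carrier G" "K #> u = K #> x" "K #> v = K #> y"
      "t \<in> K" "x \<preceq> t \<otimes> y"
      using c unfolding coset_le_def by blast
    obtain k where k: "k \<in> K" "u = k \<otimes> x"
      using rcos_self[OF u(1) S] unfolding xy(3) unfolding r_coset_def by auto
    obtain l where l: "l \<in> K" "y = l \<otimes> v"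
      using rcos_self[OF xy(2) S] unfolding xy(4)[symmetric] unfolding r_coset_def by auto
    define r where "r = k \<otimes> t \<otimes> l"
    have r: "r \<in> K" using k l xy r_def by simp
    have "k \<otimes> x \<preceq> k \<otimes> (t \<otimes> y)" using lm[OF xy(6)] xy k by simp
    then have ur: "u \<preceq> r \<otimes> v" using k l xy v r_def by (simp add: m_assoc)
    define w where "w = ojoin G r \<one>"
    have w: "w \<in> K" "w \<in> carrier G" "\<one> \<preceq> w" "r \<preceq> w"
      using lk[OF r one] pos jl r w_def by auto
    have "r \<otimes> v \<preceq> w \<otimes> v" using rm[OF w(4)] w r v by simp
    then have uw: "u \<preceq> w \<otimes> v" using ur tr[OF ur] w r u v by simp
    have uw': "u \<preceq> w \<otimes> u" using rm[OF w(3)] w u by fastforce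
    have sh: "inv w \<otimes> u \<preceq> z" if "z \<in> carrier G" "u \<preceq> w \<otimes> z" for z
    proof -
      have "inv w \<otimes> u \<preceq> inv w \<otimes> (w \<otimes> z)" using lm[OF that(2)] that w u by simp
      then show ?thesis using that w u by (simp add: m_assoc[symmetric])
    qed
    have "inv w \<otimes> u \<preceq> omeet G u v"
      using mle[OF sh[OF u(1) uw'] sh[OF v uw]] u v w by simp
    then have "w \<otimes> (inv w \<otimes> u) \<preceq> w \<otimes> omeet G u v"
      using lm w u v cl by simp
    then have "u \<preceq> w \<otimes> omeet G u v"
      using w u v cl by (simp add: m_assoc[symmetric])
    then show ?thesis using conv[OF one S.m_closed[OF w(1) m] u(1,2)] by blast
  qed
  have prime: "u \<in> K \<or> v \<in> K" if u: "u \<in> carrier G" "\<one> \<preceq> u" and v: "v \<in> carrier G" "\<one> \<preceq> v"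
    and m: "omeet G u v \<in> K" for u v
  proof -
    have "K #> u \<in> rcosets K" "K #> v \<in> rcosets K" using u v S.subset by (auto simp: RCOSETS_def)
    then consider "coset_le G K (K #> u) (K #> v)" | "coset_le G K (K #> v) (K #> u)"
      using tot by blast
    then show ?thesis
      using key[OF u v(1) m] key[OF v u(1)] m by cases (auto simp: meet_def insert_commute)
  qed
  have ex: "\<exists>a'\<in>{a, inv a}. ojoin G a' \<one> \<notin> K" if a: "a \<in> carrier G" "a \<notin> K" for a
  proof (rule ccontr)
    assume "\<not> ?thesis"
    then have j: "ojoin G a \<one> \<in> K" "ojoin G (inv a) \<one> \<in> K" by auto
    let ?w = "ojoin G (inv a) \<one>"
    have w: "?w \<in> carrier G" using j by simp
    have "inv ?w \<otimes> inv a \<otimes> a \<preceq> inv ?w \<otimes> ?w \<otimes> a" 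
      by (rule mult_mono) (use jl a w in auto)
    then have "inv ?w \<preceq> a" using a w by (simp add: m_assoc)
    then show False using conv[of "inv ?w" "ojoin G a \<one>" a] j a jl by simp
  qed
  have mem: "ojoin G a' \<one> \<in> K" if "a \<in> K" "a' \<in> {a, inv a}" for a a'
    using that lk one by auto
  show ?thesis
  proof (intro iffI)
    assume "\<not> A \<subseteq> K \<and> \<not> B \<subseteq> K"
    then obtain a b where ab: "a \<in> A" "a \<notin> K" "b \<in> B" "b \<notin> K" by blast
    obtain a' b' where ab': "a' \<in> {a, inv a}" "ojoin G a' \<one> \<notin> K"
      "b' \<in> {b, inv b}" "ojoin G b' \<one> \<notin> K"
      using ex ab A B by (meson subsetD)
    have c: "a' \<in> carrier G" "b' \<in> carrier G" using ab ab' A B by auto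
    have "omeet G (ojoin G a' \<one>) (ojoin G b' \<one>) \<notin> K"
      using prime pos c ab' by blast
    moreover have "a' \<in> A \<union> m_inv G ` A" "b' \<in> B \<union> m_inv G ` B" using ab ab' by auto
    ultimately show "\<not> {omeet G (ojoin G a \<one>) (ojoin G b \<one>) | a b.
        a \<in> A \<union> m_inv G ` A \<and> b \<in> B \<union> m_inv G ` B} \<subseteq> K" by blast
  next
    assume "\<not> {omeet G (ojoin G a \<one>) (ojoin G b \<one>) | a b.
        a \<in> A \<union> m_inv G ` A \<and> b \<in> B \<union> m_inv G ` B} \<subseteq> K"
    then obtain a' b' where n: "omeet G (ojoin G a' \<one>) (ojoin G b' \<one>) \<notin> K"
      and "a' \<in> A \<union> m_inv G ` A" "b' \<in> B \<union> m_inv G ` B" by blast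
    then obtain a b where ab: "a \<in> A" "a' \<in> {a, inv a}" "b \<in> B" "b' \<in> {b, inv b}" by blast
    have c: "a' \<in> carrier G" "b' \<in> carrier G" using ab A B by auto
    let ?u = "ojoin G a' \<one>" and ?v = "ojoin G b' \<one>"
    have p: "?u \<in> carrier G" "?v \<in> carrier G" "\<one> \<preceq> ?u" "\<one> \<preceq> ?v" using pos c by auto
    have q: "\<one> \<preceq> omeet G ?u ?v" "omeet G ?u ?v \<in> carrier G" using mle p cl by auto
    have "?u \<notin> K" "?v \<notin> K" using conv[OF one _ q(2,1)] ml mr p n by blast+
    then show "\<not> A \<subseteq> K \<and> \<not> B \<subseteq> K" using mem ab by blast
  qed
qed

lemma (in l_group) openin_Spec_topology:
  "openin (Spec_topology G) U \<longleftrightarrow> (\<exists>A\<subseteq>carrier G. U = SS G A)"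
proof -
  have "istopology (\<lambda>U. \<exists>A\<subseteq>carrier G. U = SS G A)"
    unfolding istopology_def
  proof (intro conjI allI impI)
    fix U W assume "\<exists>A\<subseteq>carrier G. U = SS G A" "\<exists>A\<subseteq>carrier G. W = SS G A"
    then obtain A B where AB: "A \<subseteq> carrier G" "U = SS G A" "B \<subseteq> carrier G" "W = SS G B" by blast
    let ?D = "{omeet G (ojoin G a \<one>) (ojoin G b \<one>) | a b.
      a \<in> A \<union> m_inv G ` A \<and> b \<in> B \<union> m_inv G ` B}"
    interpret L: lattice "order_of G" by (rule lat)
    have [simp]: "carrier (order_of G) = carrier G" by (simp add: order_of_def)
    have sub: "A \<union> m_inv G ` A \<subseteq> carrier G" "B \<union> m_inv G ` B \<subseteq> carrier G" using AB by auto
    have "omeet G (ojoin G a \<one>) (ojoin G b \<one>) \<in> carrier G"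
      if "a \<in> carrier G" "b \<in> carrier G" for a b
      using that L.join_closed[simplified] L.meet_closed[simplified] by simp
    then have "?D \<subseteq> carrier G" using sub by blast
    moreover have "U \<inter> W = SS G ?D"
    proof (rule Set.set_eqI)
      fix K
      show "K \<in> U \<inter> W \<longleftrightarrow> K \<in> SS G ?D"
        using prime_inter_char[OF _ AB(1,3), of K] unfolding AB(2,4) SS_def Spec_def
        by (simp only: Int_iff mem_Collect_eq) argo
    qed
    ultimately show "\<exists>A\<subseteq>carrier G. U \<inter> W = SS G A" by blast
  next
    fix \<K> assume "\<forall>U\<in>\<K>. \<exists>A\<subseteq>carrier G. U = SS G A"
    then obtain f where f: "\<And>U. U \<in> \<K> \<Longrightarrow> f U \<subseteq> carrier G \<and> U = SS G (f U)" by metis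
    have "\<Union>\<K> = SS G (\<Union>(f ` \<K>))" using f unfolding SS_def by blast
    then show "\<exists>A\<subseteq>carrier G. \<Union>\<K> = SS G A" using f by (intro exI[of _ "\<Union>(f ` \<K>)"]) auto
  qed
  then show ?thesis unfolding Spec_topology_def by (simp add: topology_inverse')
qed

definition Spec_star_topology :: "('a, 'm) ogroup_scheme \<Rightarrow> 'a set topology" where
  "Spec_star_topology H = subtopology (Spec_topology H) (Spec_star H)"

definition h_of :: "('g, 'm) ogroup_scheme \<Rightarrow> ('f, 'n) ogroup_scheme \<Rightarrow> ('g \<Rightarrow> 'f) \<Rightarrow> 'g set
    \<Rightarrow> 'f \<Rightarrow> 'g set \<Rightarrow> 'g set" where
  "h_of G F \<eta> C = (THE h. h \<in> extensional (carrier F) \<and> l_hom F (H_of G C) h \<and>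
     (\<forall>a\<in>carrier G. h (\<eta> a) = R_map G C a))"

definition kappa ::
  "('g, 'm) ogroup_scheme \<Rightarrow> ('f, 'n) ogroup_scheme \<Rightarrow> ('g \<Rightarrow> 'f) \<Rightarrow> 'g set \<Rightarrow> 'f set" where
  "kappa G F \<eta> C = h_of G F \<eta> C -`
     {f \<in> carrier (H_of G C). f (equiv_of G C `` {\<one>\<^bsub>G\<^esub>}) = equiv_of G C `` {\<one>\<^bsub>G\<^esub>}}
     \<inter> carrier F"

definition prime_rel ::
  "('g, 'm) ogroup_scheme \<Rightarrow> ('f, 'n) ogroup_scheme \<Rightarrow> ('g \<Rightarrow> 'f) \<Rightarrow> 'f set \<Rightarrow> 'g rel" where
  "prime_rel G F \<eta> P = {(a, b). a \<in> carrier G \<and> b \<in> carrier G \<and>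
     coset_le F P (P #>\<^bsub>F\<^esub> \<eta> a) (P #>\<^bsub>F\<^esub> \<eta> b)}"

definition ppi ::
  "('g, 'm) ogroup_scheme \<Rightarrow> ('f, 'n) ogroup_scheme \<Rightarrow> ('g \<Rightarrow> 'f) \<Rightarrow> 'f set \<Rightarrow> 'g set" where
  "ppi G F \<eta> P = cone_of G (prime_rel G F \<eta> P)"

end

theory Submission
  imports Defs
begin

text \<open>
  By the universal property \<open>F\<close> is generated by the image of \<open>\<eta>\<close>, and, since translations
  are lattice automorphisms, already as a lattice. For a prime \<open>P\<close> of \<open>F\<close> the cosets form a
  chain, so every coset contains some \<open>\<eta> a\<close>; this identifies the chain of cosets with
  \<open>\<Omega>\<^sub>C\<close> for \<open>C = \<pi>(P)\<close>. The right action of \<open>F\<close> on it is an \<open>\<ell>\<close>-homomorphism onto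
  \<open>H\<^sub>C\<close> extending \<open>R\<^sub>C\<close>. Hence \<open>H\<^sub>C\<close> lies in the variety, the action is \<open>h\<^sub>C\<close>, and \<open>P\<close> is
  the stabilizer of \<open>[e]\<close>, that is \<open>\<kappa>(\<pi>(P)) = P\<close>. Conversely, in a chain the stabilizer of
  a point is prime and orders its cosets as the point is moved, which gives \<open>\<pi>(\<kappa>(C)) = C\<close>.
\<close>

section \<open>Lattice-ordered groups\<close>

text \<open>The universal property is applied to test objects on two types. Test objects on the type
  of \<open>F\<close> itself, namely \<open>F\<close> and a carrier restriction of it, show that
  \<open>F\<close> is generated by the image of \<open>\<eta>\<close>; the l-groups
  \<open>H_of G C\<close>, made of maps on classes, supply \<open>h_of\<close>.

  The obstacle for order and topology is that membership in a prime \<open>P\<close> is not decided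
  on lattice words by membership of the letters: if \<open>x\<close> is outside \<open>P\<close> and
  \<open>y\<close> in \<open>P\<close>, their join may lie inside or outside. The remedy is to
  replace membership by strict positivity, "the coset of \<open>x\<close> lies strictly above
  \<open>P\<close>", written as the negation of \<open>coset_below F P x \<one>\<close>. As the
  cosets form a chain, joins become disjunctions and meets become conjunctions. Membership is
  recovered because \<open>x\<close> is in \<open>P\<close> iff neither \<open>x\<close> nor its
  inverse is strictly positive. On \<open>\<eta> a\<close> strict positivity is the subbasic
  condition that \<open>a\<close> is in the cone and \<open>inv a\<close> is not.\<close>

lemma order_of_simps [simp]:
  "carrier (order_of G) = carrier G"
  "x \<sqsubseteq>\<^bsub>order_of G\<^esub> y \<longleftrightarrow> x \<preceq>\<^bsub>G\<^esub> y"
  "x .=\<^bsub>order_of G\<^esub> y \<longleftrightarrow> x = y"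
  by (simp_all add: order_of_def)

context po_group
begin

lemma ole_refl [simp]: "x \<in> carrier G \<Longrightarrow> x \<preceq> x"
proof -
  interpret P: partial_order "order_of G" by (rule po)
  show "x \<in> carrier G \<Longrightarrow> x \<preceq> x" using P.le_refl by simp
qed

lemma ole_antisym:
  "\<lbrakk>x \<preceq> y; y \<preceq> x; x \<in> carrier G; y \<in> carrier G\<rbrakk> \<Longrightarrow> x = y"
proof -
  interpret P: partial_order "order_of G" by (rule po)
  show "\<lbrakk>x \<preceq> y; y \<preceq> x; x \<in> carrier G; y \<in> carrier G\<rbrakk> \<Longrightarrow> x = y"
    using P.le_antisym by simp
qed

lemma ole_trans:
  "\<lbrakk>x \<preceq> y; y \<preceq> z; x \<in> carrier G; y \<in> carrier G; z \<in> carrier G\<rbrakk> \<Longrightarrow> x \<preceq> z"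
proof -
  interpret P: partial_order "order_of G" by (rule po)
  show "\<lbrakk>x \<preceq> y; y \<preceq> z; x \<in> carrier G; y \<in> carrier G; z \<in> carrier G\<rbrakk> \<Longrightarrow> x \<preceq> z"
    using P.le_trans by simp
qed

lemma mult_left_mono:
  "\<lbrakk>x \<preceq> y; s \<in> carrier G; x \<in> carrier G; y \<in> carrier G\<rbrakk> \<Longrightarrow> s \<otimes> x \<preceq> s \<otimes> y"
  using mult_mono[of x y s \<one>] by simp

lemma mult_right_mono:
  "\<lbrakk>x \<preceq> y; s \<in> carrier G; x \<in> carrier G; y \<in> carrier G\<rbrakk> \<Longrightarrow> x \<otimes> s \<preceq> y \<otimes> s"
  using mult_mono[of x y \<one> s] by simp

lemma mult_left_le_iff:
  "\<lbrakk>s \<in> carrier G; x \<in> carrier G; y \<in> carrier G\<rbrakk> \<Longrightarrow> s \<otimes> x \<preceq> s \<otimes> y \<longleftrightarrow> x \<preceq> y"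
  using mult_left_mono[of "s \<otimes> x" "s \<otimes> y" "inv s"] mult_left_mono[of x y s]
  by (auto simp: m_assoc[symmetric])

lemma mult_right_le_iff:
  "\<lbrakk>s \<in> carrier G; x \<in> carrier G; y \<in> carrier G\<rbrakk> \<Longrightarrow> x \<otimes> s \<preceq> y \<otimes> s \<longleftrightarrow> x \<preceq> y"
  using mult_right_mono[of "x \<otimes> s" "y \<otimes> s" "inv s"] mult_right_mono[of x y s]
  by (auto simp: m_assoc)

lemma inv_le_iff:
  "\<lbrakk>x \<in> carrier G; y \<in> carrier G\<rbrakk> \<Longrightarrow> inv x \<preceq> inv y \<longleftrightarrow> y \<preceq> x"
  using mult_left_le_iff[of x "inv x" "inv y"] mult_right_le_iff[of y \<one> "x \<otimes> inv y"]
  by (simp add: m_assoc)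

text \<open>\<open>join\<close> is a Hilbert choice among least upper bounds. Antisymmetry leaves a
  single candidate, so the value is known in any \<open>po_group\<close>, before the existence of
  other joins is established.\<close>

lemma ojoin_eqI:
  assumes c: "x \<in> carrier G" "y \<in> carrier G" "z \<in> carrier G"
    and ub: "x \<preceq> z" "y \<preceq> z"
    and lub: "\<And>w. \<lbrakk>w \<in> carrier G; x \<preceq> w; y \<preceq> w\<rbrakk> \<Longrightarrow> z \<preceq> w"
  shows "ojoin G x y = z"
proof -
  have *: "least (order_of G) w (Upper (order_of G) {x, y}) \<longleftrightarrow> w = z" for w
    using c ub lub ole_antisym by (fastforce simp: least_def Upper_def)
  show ?thesis unfolding join_def sup_def * by simp
qed

lemma omeet_eqI:
  assumes c: "x \<in> carrier G" "y \<in> carrier G" "z \<in> carrier G"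
    and lb: "z \<preceq> x" "z \<preceq> y"
    and glb: "\<And>w. \<lbrakk>w \<in> carrier G; w \<preceq> x; w \<preceq> y\<rbrakk> \<Longrightarrow> w \<preceq> z"
  shows "omeet G x y = z"
proof -
  have *: "greatest (order_of G) w (Lower (order_of G) {x, y}) \<longleftrightarrow> w = z" for w
    using c lb glb ole_antisym by (fastforce simp: greatest_def Lower_def)
  show ?thesis unfolding meet_def inf_def * by simp
qed

lemma l_groupI:
  assumes join: "\<And>x y. \<lbrakk>x \<in> carrier G; y \<in> carrier G\<rbrakk> \<Longrightarrow> \<exists>z\<in>carrier G. x \<preceq> z \<and> y \<preceq> z \<and>
      (\<forall>w\<in>carrier G. x \<preceq> w \<longrightarrow> y \<preceq> w \<longrightarrow> z \<preceq> w)"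
    and meet: "\<And>x y. \<lbrakk>x \<in> carrier G; y \<in> carrier G\<rbrakk> \<Longrightarrow> \<exists>z\<in>carrier G. z \<preceq> x \<and> z \<preceq> y \<and>
      (\<forall>w\<in>carrier G. w \<preceq> x \<longrightarrow> w \<preceq> y \<longrightarrow> w \<preceq> z)"
  shows "l_group G"
proof -
  interpret P: partial_order "order_of G" by (rule po)
  have "lattice (order_of G)"
  proof
    fix x y assume "x \<in> carrier (order_of G)" "y \<in> carrier (order_of G)"
    then have c: "x \<in> carrier G" "y \<in> carrier G" by simp_all
    show "\<exists>s. least (order_of G) s (Upper (order_of G) {x, y})"
    proof -
      obtain z where "z \<in> carrier G" "x \<preceq> z" "y \<preceq> z"
        "\<forall>w\<in>carrier G. x \<preceq> w \<longrightarrow> y \<preceq> w \<longrightarrow> z \<preceq> w"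
        using join[OF c] by blast
      then show ?thesis using c by (intro exI[of _ z]) (simp add: least_def Upper_def)
    qed
    show "\<exists>s. greatest (order_of G) s (Lower (order_of G) {x, y})"
    proof -
      obtain z where "z \<in> carrier G" "z \<preceq> x" "z \<preceq> y"
        "\<forall>w\<in>carrier G. w \<preceq> x \<longrightarrow> w \<preceq> y \<longrightarrow> w \<preceq> z"
        using meet[OF c] by blast
      then show ?thesis using c by (intro exI[of _ z]) (simp add: greatest_def Lower_def)
    qed
  qed
  then show ?thesis by (intro l_group.intro po_group_axioms l_group_axioms.intro)
qed

end

context l_group
begin

lemma ojoin:
  assumes "x \<in> carrier G" "y \<in> carrier G"
  shows ojoin_closed [simp]: "ojoin G x y \<in> carrier G"
    and ojoin_left: "x \<preceq> ojoin G x y"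
    and ojoin_right: "y \<preceq> ojoin G x y"
    and ojoin_least: "\<lbrakk>x \<preceq> z; y \<preceq> z; z \<in> carrier G\<rbrakk> \<Longrightarrow> ojoin G x y \<preceq> z"
proof -
  interpret L: lattice "order_of G" by (rule lat)
  show "ojoin G x y \<in> carrier G" "x \<preceq> ojoin G x y" "y \<preceq> ojoin G x y"
    "\<lbrakk>x \<preceq> z; y \<preceq> z; z \<in> carrier G\<rbrakk> \<Longrightarrow> ojoin G x y \<preceq> z"
    using assms L.join_closed L.join_left L.join_right L.join_le by simp_all
qed

lemma omeet:
  assumes "x \<in> carrier G" "y \<in> carrier G"
  shows omeet_closed [simp]: "omeet G x y \<in> carrier G"
    and omeet_left: "omeet G x y \<preceq> x"
    and omeet_right: "omeet G x y \<preceq> y"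
    and omeet_greatest: "\<lbrakk>z \<preceq> x; z \<preceq> y; z \<in> carrier G\<rbrakk> \<Longrightarrow> z \<preceq> omeet G x y"
proof -
  interpret L: lattice "order_of G" by (rule lat)
  show "omeet G x y \<in> carrier G" "omeet G x y \<preceq> x" "omeet G x y \<preceq> y"
    "\<lbrakk>z \<preceq> x; z \<preceq> y; z \<in> carrier G\<rbrakk> \<Longrightarrow> z \<preceq> omeet G x y"
    using assms L.meet_closed L.meet_left L.meet_right L.meet_le by simp_all
qed

text \<open>Translation by \<open>s\<close> is an order automorphism whose inverse is translation by
  \<open>inv s\<close>; an upper bound \<open>w\<close> of the translated pair is pulled back to
  \<open>inv s \<otimes> w\<close>. The three companions follow the same pattern.\<close>

lemma mult_ojoin_left:
  assumes c: "s \<in> carrier G" "x \<in> carrier G" "y \<in> carrier G"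
  shows "s \<otimes> ojoin G x y = ojoin G (s \<otimes> x) (s \<otimes> y)"
proof (rule ojoin_eqI[symmetric])
  fix w assume w: "w \<in> carrier G" "s \<otimes> x \<preceq> w" "s \<otimes> y \<preceq> w"
  have "ojoin G x y \<preceq> inv s \<otimes> w"
    using w c mult_left_le_iff[of s x "inv s \<otimes> w"] mult_left_le_iff[of s y "inv s \<otimes> w"]
    by (intro ojoin_least) (simp_all add: m_assoc[symmetric])
  then show "s \<otimes> ojoin G x y \<preceq> w"
    using w c mult_left_le_iff[of s "ojoin G x y" "inv s \<otimes> w"]
    by (simp add: m_assoc[symmetric])
qed (use c ojoin_left ojoin_right in \<open>simp_all add: mult_left_le_iff\<close>)

lemma mult_ojoin_right:
  assumes c: "s \<in> carrier G" "x \<in> carrier G" "y \<in> carrier G"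
  shows "ojoin G x y \<otimes> s = ojoin G (x \<otimes> s) (y \<otimes> s)"
proof (rule ojoin_eqI[symmetric])
  fix w assume w: "w \<in> carrier G" "x \<otimes> s \<preceq> w" "y \<otimes> s \<preceq> w"
  have "ojoin G x y \<preceq> w \<otimes> inv s"
    using w c mult_right_le_iff[of s x "w \<otimes> inv s"] mult_right_le_iff[of s y "w \<otimes> inv s"]
    by (intro ojoin_least) (simp_all add: m_assoc)
  then show "ojoin G x y \<otimes> s \<preceq> w"
    using w c mult_right_le_iff[of s "ojoin G x y" "w \<otimes> inv s"]
    by (simp add: m_assoc)
qed (use c ojoin_left ojoin_right in \<open>simp_all add: mult_right_le_iff\<close>)

lemma mult_omeet_left:
  assumes c: "s \<in> carrier G" "x \<in> carrier G" "y \<in> carrier G"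
  shows "s \<otimes> omeet G x y = omeet G (s \<otimes> x) (s \<otimes> y)"
proof (rule omeet_eqI[symmetric])
  fix w assume w: "w \<in> carrier G" "w \<preceq> s \<otimes> x" "w \<preceq> s \<otimes> y"
  have "inv s \<otimes> w \<preceq> omeet G x y"
    using w c mult_left_le_iff[of s "inv s \<otimes> w" x] mult_left_le_iff[of s "inv s \<otimes> w" y]
    by (intro omeet_greatest) (simp_all add: m_assoc[symmetric])
  then show "w \<preceq> s \<otimes> omeet G x y"
    using w c mult_left_le_iff[of s "inv s \<otimes> w" "omeet G x y"]
    by (simp add: m_assoc[symmetric])
qed (use c omeet_left omeet_right in \<open>simp_all add: mult_left_le_iff\<close>)

lemma mult_omeet_right:
  assumes c: "s \<in> carrier G" "x \<in> carrier G" "y \<in> carrier G"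
  shows "omeet G x y \<otimes> s = omeet G (x \<otimes> s) (y \<otimes> s)"
proof (rule omeet_eqI[symmetric])
  fix w assume w: "w \<in> carrier G" "w \<preceq> x \<otimes> s" "w \<preceq> y \<otimes> s"
  have "w \<otimes> inv s \<preceq> omeet G x y"
    using w c mult_right_le_iff[of s "w \<otimes> inv s" x] mult_right_le_iff[of s "w \<otimes> inv s" y]
    by (intro omeet_greatest) (simp_all add: m_assoc)
  then show "w \<preceq> omeet G x y \<otimes> s"
    using w c mult_right_le_iff[of s "w \<otimes> inv s" "omeet G x y"]
    by (simp add: m_assoc)
qed (use c omeet_left omeet_right in \<open>simp_all add: mult_right_le_iff\<close>)

lemma inv_ojoin:
  assumes c: "x \<in> carrier G" "y \<in> carrier G"
  shows "inv (ojoin G x y) = omeet G (inv x) (inv y)"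
proof (rule omeet_eqI[symmetric])
  fix w assume w: "w \<in> carrier G" "w \<preceq> inv x" "w \<preceq> inv y"
  have "ojoin G x y \<preceq> inv w"
    using w c inv_le_iff[of "inv w" x] inv_le_iff[of "inv w" y] by (intro ojoin_least) simp_all
  then show "w \<preceq> inv (ojoin G x y)" using w c inv_le_iff[of "inv w" "ojoin G x y"] by simp
qed (use c ojoin_left ojoin_right in \<open>simp_all add: inv_le_iff\<close>)

lemma inv_omeet:
  assumes c: "x \<in> carrier G" "y \<in> carrier G"
  shows "inv (omeet G x y) = ojoin G (inv x) (inv y)"
  using inv_ojoin[of "inv x" "inv y"] c by (metis inv_closed inv_inv omeet_closed ojoin_closed)

lemma l_subgroup_carrier: "l_subgroup (carrier G) G"
  by (simp add: l_subgroup_def subgroup_self)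

lemma l_subgroup_l_generated: "l_subgroup (l_generated G A) G" if "A \<subseteq> carrier G"
proof -
  let ?S = "{K. l_subgroup K G \<and> A \<subseteq> K}"
  have "carrier G \<in> ?S" using that l_subgroup_carrier by simp
  then have "subgroup (\<Inter>?S) G"
    by (intro subgroups_Inter) (auto simp: l_subgroup_def)
  then show ?thesis by (auto simp: l_generated_def l_subgroup_def)
qed

lemma l_generated_incl: "A \<subseteq> l_generated G A"
  by (auto simp: l_generated_def)

lemma l_generated_minimal: "l_subgroup K G \<Longrightarrow> A \<subseteq> K \<Longrightarrow> l_generated G A \<subseteq> K"
  by (auto simp: l_generated_def)

end

text \<open>There are no rules for products and inverses: over a subgroup \<open>A\<close> the
  closure under joins and meets is already a subgroup, and inductions keep only the lattice
  cases.\<close>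

inductive_set lattice_span :: "('a, 'm) ogroup_scheme \<Rightarrow> 'a set \<Rightarrow> 'a set" for G A where
  incl: "x \<in> A \<Longrightarrow> x \<in> lattice_span G A"
| join: "x \<in> lattice_span G A \<Longrightarrow> y \<in> lattice_span G A \<Longrightarrow> ojoin G x y \<in> lattice_span G A"
| meet: "x \<in> lattice_span G A \<Longrightarrow> y \<in> lattice_span G A \<Longrightarrow> omeet G x y \<in> lattice_span G A"

context l_group
begin

lemma lattice_span_closed:
  assumes "A \<subseteq> carrier G" "x \<in> lattice_span G A"
  shows "x \<in> carrier G"
  using assms(2,1) by induction auto

text \<open>Products distribute over joins and meets on both sides, and inversion interchanges the
  two, so group operations can be pushed down to the letters. Products take two inductions: on the
  left factor with the right one in \<open>A\<close>, then on the right factor.\<close>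

lemma l_subgroup_lattice_span:
  assumes A: "subgroup A G"
  shows "l_subgroup (lattice_span G A) G"
proof -
  interpret A: subgroup A G by (rule A)
  note cl = lattice_span_closed[OF A.subset]
  note [simp] = cl A.mem_carrier
  have one_side: "x \<otimes> a \<in> lattice_span G A" if "x \<in> lattice_span G A" "a \<in> A" for x a
    using that(1)
    by induction (use that(2) in \<open>simp_all add: mult_ojoin_right mult_omeet_right
        lattice_span.join lattice_span.meet lattice_span.incl\<close>)
  have mult: "x \<otimes> y \<in> lattice_span G A" if "x \<in> lattice_span G A" "y \<in> lattice_span G A" for x y
    using that(2)
    by induction (use that(1) one_side in \<open>simp_all add: mult_ojoin_left mult_omeet_left
        lattice_span.join lattice_span.meet\<close>)
  have inv: "inv x \<in> lattice_span G A" if "x \<in> lattice_span G A" for x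
    using that
    by induction (simp_all add: inv_ojoin inv_omeet lattice_span.join lattice_span.meet
        lattice_span.incl)
  have "subgroup (lattice_span G A) G"
  proof (rule subgroupI)
    show "lattice_span G A \<noteq> {}" using lattice_span.incl[OF A.one_closed, of G] by blast
  qed (use mult inv in auto)
  then show ?thesis
    by (simp add: l_subgroup_def lattice_span.join lattice_span.meet)
qed

lemma sub_l_group:
  assumes K: "l_subgroup K G"
  shows "l_group (G\<lparr>carrier := K\<rparr>)"
    and "\<lbrakk>x \<in> K; y \<in> K\<rbrakk> \<Longrightarrow> ojoin (G\<lparr>carrier := K\<rparr>) x y = ojoin G x y"
    and "\<lbrakk>x \<in> K; y \<in> K\<rbrakk> \<Longrightarrow> omeet (G\<lparr>carrier := K\<rparr>) x y = omeet G x y"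
proof -
  have S: "subgroup K G" and jm: "\<And>x y. x \<in> K \<Longrightarrow> y \<in> K \<Longrightarrow> ojoin G x y \<in> K"
    "\<And>x y. x \<in> K \<Longrightarrow> y \<in> K \<Longrightarrow> omeet G x y \<in> K"
    using K by (auto simp: l_subgroup_def)
  interpret S: subgroup K G by (rule S)
  have "partial_order (order_of (G\<lparr>carrier := K\<rparr>))"
    by unfold_locales (use ole_antisym ole_trans in \<open>auto simp: order_of_def\<close>)
  then interpret K: po_group "G\<lparr>carrier := K\<rparr>"
    by (intro po_group.intro subgroup_imp_group[OF S] po_group_axioms.intro)
      (auto intro: mult_mono)
  show j: "ojoin (G\<lparr>carrier := K\<rparr>) x y = ojoin G x y" if "x \<in> K" "y \<in> K" for x y
    using that jm ojoin_left ojoin_right ojoin_least by (intro K.ojoin_eqI) auto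
  show m: "omeet (G\<lparr>carrier := K\<rparr>) x y = omeet G x y" if "x \<in> K" "y \<in> K" for x y
    using that jm omeet_left omeet_right omeet_greatest by (intro K.omeet_eqI) auto
  show "l_group (G\<lparr>carrier := K\<rparr>)"
  proof (rule K.l_groupI)
    fix x y assume "x \<in> carrier (G\<lparr>carrier := K\<rparr>)" "y \<in> carrier (G\<lparr>carrier := K\<rparr>)"
    then have "x \<in> K" "y \<in> K" by simp_all
    then show "\<exists>z\<in>carrier (G\<lparr>carrier := K\<rparr>). x \<preceq>\<^bsub>G\<lparr>carrier := K\<rparr>\<^esub> z \<and> y \<preceq>\<^bsub>G\<lparr>carrier := K\<rparr>\<^esub> z \<and>
        (\<forall>w\<in>carrier (G\<lparr>carrier := K\<rparr>). x \<preceq>\<^bsub>G\<lparr>carrier := K\<rparr>\<^esub> w \<longrightarrow> y \<preceq>\<^bsub>G\<lparr>carrier := K\<rparr>\<^esub> w \<longrightarrow>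
          z \<preceq>\<^bsub>G\<lparr>carrier := K\<rparr>\<^esub> w)"
      "\<exists>z\<in>carrier (G\<lparr>carrier := K\<rparr>). z \<preceq>\<^bsub>G\<lparr>carrier := K\<rparr>\<^esub> x \<and> z \<preceq>\<^bsub>G\<lparr>carrier := K\<rparr>\<^esub> y \<and>
        (\<forall>w\<in>carrier (G\<lparr>carrier := K\<rparr>). w \<preceq>\<^bsub>G\<lparr>carrier := K\<rparr>\<^esub> x \<longrightarrow> w \<preceq>\<^bsub>G\<lparr>carrier := K\<rparr>\<^esub> y \<longrightarrow>
          w \<preceq>\<^bsub>G\<lparr>carrier := K\<rparr>\<^esub> z)"
      using jm[of x y] ojoin_left[of x y] ojoin_right[of x y] ojoin_least[of x y]
        omeet_left[of x y] omeet_right[of x y] omeet_greatest[of x y]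
      by auto
  qed
qed

section \<open>Terms, and closure of varieties under l-subgroups and images\<close>

lemma leval_closed:
  assumes "\<forall>n. v n \<in> carrier G"
  shows "leval G v s \<in> carrier G"
  using assms by (induction s) auto

lemma leval_sub:
  assumes K: "l_subgroup K G" and v: "\<forall>n. v n \<in> K"
  shows "leval (G\<lparr>carrier := K\<rparr>) v s = leval G v s"
proof -
  interpret K: l_group "G\<lparr>carrier := K\<rparr>" by (rule sub_l_group[OF K])
  have cl: "leval (G\<lparr>carrier := K\<rparr>) v s \<in> K" for s using K.leval_closed v by simp
  have S: "subgroup K G" using K by (simp add: l_subgroup_def)
  show ?thesis
  proof (induction s)
    case (Inv s)
    have "leval G v s \<in> K" using cl[of s] Inv by simp
    then show ?case using Inv m_inv_consistent[OF S] by simp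
  next
    case (Join s t)
    then show ?case using cl[of s] cl[of t] sub_l_group(2)[OF K] by simp
  next
    case (Meet s t)
    then show ?case using cl[of s] cl[of t] sub_l_group(3)[OF K] by simp
  qed simp_all
qed

lemma in_variety_sub:
  assumes V: "in_variety V G" and K: "l_subgroup K G"
  shows "in_variety V (G\<lparr>carrier := K\<rparr>)"
proof -
  have "K \<subseteq> carrier G" using K by (auto simp: l_subgroup_def dest: subgroup.subset)
  then have "\<forall>n. v n \<in> carrier G" if "\<forall>n. v n \<in> K" for v :: "nat \<Rightarrow> 'a"
    using that by blast
  then show ?thesis
    using V sub_l_group(1)[OF K] unfolding in_variety_def by (auto simp: leval_sub[OF K])
qed

end

lemma leval_l_hom:
  assumes "l_group F" "l_group H" "l_hom F H h" "\<forall>n. v n \<in> carrier F"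
  shows "leval H (\<lambda>n. h (v n)) s = h (leval F v s)"
proof -
  interpret F: l_group F by fact
  interpret H: l_group H by fact
  interpret group_hom F H h
    using assms(3) by unfold_locales (simp add: l_hom_def)
  show ?thesis
  proof (induction s)
    case (Join s t)
    then show ?case using assms(3) F.leval_closed[OF assms(4)] by (simp add: l_hom_def)
  next
    case (Meet s t)
    then show ?case using assms(3) F.leval_closed[OF assms(4)] by (simp add: l_hom_def)
  qed (simp_all add: F.leval_closed[OF assms(4)])
qed

text \<open>A valuation in \<open>H\<close> is lifted letter by letter to preimages in
  \<open>F\<close>, where the equation holds. This is what later places \<open>H_of G C\<close>, as
  an image of the free object, in the variety.\<close>

lemma in_variety_image:
  assumes V: "in_variety V F" and H: "l_group H" and h: "l_hom F H h"
    and surj: "carrier H \<subseteq> h ` carrier F"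
  shows "in_variety V H"
proof -
  have F: "l_group F" using V by (simp add: in_variety_def)
  have "leval H v s = leval H v t" if "(s, t) \<in> V" and v: "\<forall>n. v n \<in> carrier H" for v s t
  proof -
    have "\<forall>n. \<exists>x\<in>carrier F. v n = h x" using v surj by blast
    then obtain u where u: "\<forall>n. u n \<in> carrier F" "v = (\<lambda>n. h (u n))" by metis
    have "leval F u s = leval F u t" using V that(1) u(1) unfolding in_variety_def by blast
    then show ?thesis unfolding u(2) using leval_l_hom[OF F H h u(1)] by simp
  qed
  then show ?thesis using H by (auto simp: in_variety_def)
qed

section \<open>Cosets of primes\<close>

text \<open>This is the order \<open>Kx \<le> Ky\<close> of right cosets, expressed through representatives.\<close>

definition coset_below :: "('a, 'm) ogroup_scheme \<Rightarrow> 'a set \<Rightarrow> 'a \<Rightarrow> 'a \<Rightarrow> bool" where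
  "coset_below G K x y \<longleftrightarrow> (\<exists>t\<in>K. x \<preceq>\<^bsub>G\<^esub> t \<otimes>\<^bsub>G\<^esub> y)"

text \<open>Convexity is kept apart from primeness so that the coset order is available while
  primeness is still being proved, as happens for stabilizers.\<close>

locale convex_in_l_group = l_group G for G :: "('a, 'm) ogroup_scheme" (structure) +
  fixes K :: "'a set"
  assumes convex: "convex_l_subgroup K G"
begin

abbreviation below (infix \<open>\<lesssim>\<close> 50) where "x \<lesssim> y \<equiv> coset_below G K x y"

lemma subgroup: "subgroup K G"
  using convex unfolding convex_l_subgroup_def l_subgroup_def by blast

sublocale K: subgroup K G
  by (rule subgroup)

lemma ojoin_mem: "x \<in> K \<Longrightarrow> y \<in> K \<Longrightarrow> ojoin G x y \<in> K"
  and omeet_mem: "x \<in> K \<Longrightarrow> y \<in> K \<Longrightarrow> omeet G x y \<in> K"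
  using convex unfolding convex_l_subgroup_def l_subgroup_def by blast+

lemma convex_mem: "\<lbrakk>x \<preceq> y; y \<preceq> z; x \<in> K; z \<in> K; y \<in> carrier G\<rbrakk> \<Longrightarrow> y \<in> K"
  using convex unfolding convex_l_subgroup_def by blast

lemma below_if_le: "\<lbrakk>x \<preceq> y; y \<in> carrier G\<rbrakk> \<Longrightarrow> x \<lesssim> y"
  unfolding coset_below_def by (rule bexI[of _ \<one>]) simp_all

lemma below_mem_mult: "\<lbrakk>t \<in> K; y \<in> carrier G\<rbrakk> \<Longrightarrow> t \<otimes> y \<lesssim> y"
  unfolding coset_below_def by (rule bexI[of _ t]) simp_all

lemma below_refl: "x \<in> carrier G \<Longrightarrow> x \<lesssim> x"
  by (simp add: below_if_le)

lemma below_trans: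
  assumes "x \<lesssim> y" "y \<lesssim> z" and c: "x \<in> carrier G" "y \<in> carrier G" "z \<in> carrier G"
  shows "x \<lesssim> z"
proof -
  obtain s t where st: "s \<in> K" "x \<preceq> s \<otimes> y" "t \<in> K" "y \<preceq> t \<otimes> z"
    using assms unfolding coset_below_def by blast
  then have "s \<otimes> y \<preceq> s \<otimes> (t \<otimes> z)" using c by (intro mult_left_mono) auto
  then have "x \<preceq> (s \<otimes> t) \<otimes> z" using st c ole_trans[of x "s \<otimes> y"] by (simp add: m_assoc)
  then show ?thesis using st unfolding coset_below_def by blast
qed

lemma below_mult_right:
  assumes "x \<lesssim> y" and c: "x \<in> carrier G" "y \<in> carrier G" "s \<in> carrier G"
  shows "x \<otimes> s \<lesssim> y \<otimes> s"
proof -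
  obtain t where t: "t \<in> K" "x \<preceq> t \<otimes> y" using assms unfolding coset_below_def by blast
  then have "x \<otimes> s \<preceq> t \<otimes> (y \<otimes> s)"
    using c mult_right_mono[of x "t \<otimes> y" s] by (simp add: m_assoc)
  then show ?thesis using t unfolding coset_below_def by blast
qed

lemma below_mult_right_iff:
  "\<lbrakk>x \<in> carrier G; y \<in> carrier G; s \<in> carrier G\<rbrakk> \<Longrightarrow> x \<otimes> s \<lesssim> y \<otimes> s \<longleftrightarrow> x \<lesssim> y"
  using below_mult_right[of x y s] below_mult_right[of "x \<otimes> s" "y \<otimes> s" "inv s"]
  by (auto simp: m_assoc)

lemma coset_le_iff_below:
  assumes c: "x \<in> carrier G" "y \<in> carrier G"
  shows "coset_le G K (K #> x) (K #> y) \<longleftrightarrow> x \<lesssim> y"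
proof
  assume "x \<lesssim> y"
  then show "coset_le G K (K #> x) (K #> y)"
    using c unfolding coset_le_def coset_below_def by blast
next
  \<comment> \<open>\<open>coset_le\<close> only speaks of some representatives; this allows a
    change to the given ones.\<close>
  have rep: "u \<lesssim> v" if "K #> u = K #> v" "u \<in> carrier G" "v \<in> carrier G" for u v
  proof -
    have "u \<in> K #> v" using repr_independenceD[OF subgroup that(2) that(1)[symmetric]] .
    then show ?thesis using that below_mem_mult unfolding r_coset_def by blast
  qed
  assume "coset_le G K (K #> x) (K #> y)"
  then obtain x' y' where "x' \<in> carrier G" "y' \<in> carrier G" "K #> x = K #> x'" "K #> y = K #> y'"
    "x' \<lesssim> y'"
    unfolding coset_le_def coset_below_def by blast
  then show "x \<lesssim> y" using rep[of x x'] rep[of y' y] c below_trans by metis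
qed

text \<open>Convexity is used here: the two comparisons yield \<open>s\<close> and \<open>t\<close>
  in \<open>K\<close> with \<open>inv t \<preceq> x\<close> and
  \<open>x \<preceq> s\<close>.\<close>

lemma mem_iff_below:
  assumes x: "x \<in> carrier G"
  shows "x \<in> K \<longleftrightarrow> x \<lesssim> \<one> \<and> \<one> \<lesssim> x"
proof
  assume "x \<in> K"
  then show "x \<lesssim> \<one> \<and> \<one> \<lesssim> x"
    using x below_mem_mult[of x \<one>] below_mem_mult[of "inv x" x] by simp
next
  assume "x \<lesssim> \<one> \<and> \<one> \<lesssim> x"
  then obtain s t where st: "s \<in> K" "x \<preceq> s" "t \<in> K" "\<one> \<preceq> t \<otimes> x"
    unfolding coset_below_def using x by auto
  then have "inv t \<preceq> x"
    using x mult_left_le_iff[of t "inv t" x] by simp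
  then show "x \<in> K" using st x convex_mem[of "inv t" x s] by simp
qed

lemma ojoin_below_iff:
  assumes c: "x \<in> carrier G" "y \<in> carrier G" "z \<in> carrier G"
  shows "ojoin G x y \<lesssim> z \<longleftrightarrow> x \<lesssim> z \<and> y \<lesssim> z"
proof
  assume "ojoin G x y \<lesssim> z"
  then show "x \<lesssim> z \<and> y \<lesssim> z"
    using c below_if_le[OF ojoin_left[of x y]] below_if_le[OF ojoin_right[of x y]] below_trans
    by (meson ojoin_closed)
next
  assume "x \<lesssim> z \<and> y \<lesssim> z"
  then obtain s t where st: "s \<in> K" "x \<preceq> s \<otimes> z" "t \<in> K" "y \<preceq> t \<otimes> z"
    unfolding coset_below_def by blast
  \<comment> \<open>The two comparisons come with different elements of \<open>K\<close>; their
    join, again in \<open>K\<close>, serves both.\<close>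
  let ?w = "ojoin G s t"
  have w: "?w \<in> K" "s \<otimes> z \<preceq> ?w \<otimes> z" "t \<otimes> z \<preceq> ?w \<otimes> z"
    using st c ojoin_mem by (auto intro!: mult_right_mono ojoin_left ojoin_right)
  have "ojoin G x y \<preceq> ?w \<otimes> z"
    using st c w by (intro ojoin_least) (auto intro: ole_trans)
  then show "ojoin G x y \<lesssim> z" using w unfolding coset_below_def by blast
qed

lemma below_omeet_iff:
  assumes c: "x \<in> carrier G" "y \<in> carrier G" "z \<in> carrier G"
  shows "z \<lesssim> omeet G x y \<longleftrightarrow> z \<lesssim> x \<and> z \<lesssim> y"
proof
  assume "z \<lesssim> omeet G x y"
  then show "z \<lesssim> x \<and> z \<lesssim> y"
    using c below_if_le[OF omeet_left[of x y]] below_if_le[OF omeet_right[of x y]] below_trans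
    by (meson omeet_closed)
next
  assume "z \<lesssim> x \<and> z \<lesssim> y"
  then obtain s t where st: "s \<in> K" "z \<preceq> s \<otimes> x" "t \<in> K" "z \<preceq> t \<otimes> y"
    unfolding coset_below_def by blast
  let ?w = "ojoin G s t"
  have w: "?w \<in> K" "s \<otimes> x \<preceq> ?w \<otimes> x" "t \<otimes> y \<preceq> ?w \<otimes> y"
    using st c ojoin_mem by (auto intro!: mult_right_mono ojoin_left ojoin_right)
  have "z \<preceq> omeet G (?w \<otimes> x) (?w \<otimes> y)"
    using st c w by (intro omeet_greatest) (auto intro: ole_trans)
  then have "z \<preceq> ?w \<otimes> omeet G x y" using w c by (simp add: mult_omeet_left)
  then show "z \<lesssim> omeet G x y" using w unfolding coset_below_def by blast
qed

lemma prime_iff_below_total: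
  "prime_subgroup K G \<longleftrightarrow>
    K \<noteq> carrier G \<and> (\<forall>x\<in>carrier G. \<forall>y\<in>carrier G. x \<lesssim> y \<or> y \<lesssim> x)"
  using convex by (simp add: prime_subgroup_def RCOSETS_def coset_le_iff_below)

end

section \<open>Strict positivity modulo a prime\<close>

locale prime_in_l_group = l_group G for G :: "('a, 'm) ogroup_scheme" (structure) +
  fixes K :: "'a set"
  assumes prime: "prime_subgroup K G"
begin

sublocale convex_in_l_group
  using prime by unfold_locales (simp add: prime_subgroup_def)

lemma below_total: "\<lbrakk>x \<in> carrier G; y \<in> carrier G\<rbrakk> \<Longrightarrow> x \<lesssim> y \<or> y \<lesssim> x"
  using prime prime_iff_below_total by blast

lemma proper: "K \<noteq> carrier G"
  using prime by (simp add: prime_subgroup_def)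

text \<open>In a chain of cosets the meet is equivalent to one of its arguments; totality enters in
  the direction from left to right.\<close>

lemma omeet_below_iff:
  assumes c: "x \<in> carrier G" "y \<in> carrier G" "z \<in> carrier G"
  shows "omeet G x y \<lesssim> z \<longleftrightarrow> x \<lesssim> z \<or> y \<lesssim> z"
proof
  assume m: "omeet G x y \<lesssim> z"
  have "x \<lesssim> omeet G x y \<or> y \<lesssim> omeet G x y"
    using c below_total[of x y] below_refl by (auto simp: below_omeet_iff)
  then show "x \<lesssim> z \<or> y \<lesssim> z" using m c below_trans by (meson omeet_closed)
next
  assume "x \<lesssim> z \<or> y \<lesssim> z"
  then show "omeet G x y \<lesssim> z"
    using c below_if_le[OF omeet_left[of x y]] below_if_le[OF omeet_right[of x y]] below_trans
    by (meson omeet_closed)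
qed

text \<open>By totality, the negation of \<open>x \<lesssim> \<one>\<close> says that the coset of
  \<open>x\<close> is strictly above \<open>K\<close>. This rule and the next one evaluate that
  property on lattice words.\<close>

lemma positive_ojoin_iff:
  "\<lbrakk>x \<in> carrier G; y \<in> carrier G\<rbrakk> \<Longrightarrow> \<not> ojoin G x y \<lesssim> \<one> \<longleftrightarrow> \<not> x \<lesssim> \<one> \<or> \<not> y \<lesssim> \<one>"
  by (simp add: ojoin_below_iff)

lemma positive_omeet_iff:
  "\<lbrakk>x \<in> carrier G; y \<in> carrier G\<rbrakk> \<Longrightarrow> \<not> omeet G x y \<lesssim> \<one> \<longleftrightarrow> \<not> x \<lesssim> \<one> \<and> \<not> y \<lesssim> \<one>"
  by (simp add: omeet_below_iff)

lemma below_iff_inv_above: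
  "x \<in> carrier G \<Longrightarrow> x \<lesssim> \<one> \<longleftrightarrow> \<one> \<lesssim> inv x"
  using below_mult_right_iff[of x \<one> "inv x"] by simp

text \<open>The way back from strict positivity to membership.\<close>

lemma mem_iff_not_positive:
  "x \<in> carrier G \<Longrightarrow> x \<in> K \<longleftrightarrow> x \<lesssim> \<one> \<and> inv x \<lesssim> \<one>"
  using mem_iff_below[of x] below_iff_inv_above[of "inv x"] by simp

text \<open>Turns strict positivity of a single element into non-membership of a single element,
  hence into a basic open set of the spectrum; \<open>continuous_ppi\<close> relies on it.\<close>

lemma positive_iff_ojoin_not_mem:
  "x \<in> carrier G \<Longrightarrow> \<not> x \<lesssim> \<one> \<longleftrightarrow> ojoin G x \<one> \<notin> K"
  using mem_iff_below[of "ojoin G x \<one>"] below_if_le[OF ojoin_right[of x \<one>]]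
    below_refl[of \<one>] by (simp add: ojoin_below_iff)

end

section \<open>Automorphisms of chains\<close>

locale chain_set =
  fixes S :: "'x set" and r :: "'x \<Rightarrow> 'x \<Rightarrow> bool"
  assumes refl: "x \<in> S \<Longrightarrow> r x x"
    and antisym: "\<lbrakk>x \<in> S; y \<in> S; r x y; r y x\<rbrakk> \<Longrightarrow> x = y"
    and trans: "\<lbrakk>x \<in> S; y \<in> S; z \<in> S; r x y; r y z\<rbrakk> \<Longrightarrow> r x z"
    and total: "\<lbrakk>x \<in> S; y \<in> S\<rbrakk> \<Longrightarrow> r x y \<or> r y x"
begin

abbreviation "Aut \<equiv> Aut_chain S r"

definition cmax :: "('x \<Rightarrow> 'x) \<Rightarrow> ('x \<Rightarrow> 'x) \<Rightarrow> 'x \<Rightarrow> 'x" where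
  "cmax f g = (\<lambda>x\<in>S. if r (f x) (g x) then g x else f x)"

definition cmin :: "('x \<Rightarrow> 'x) \<Rightarrow> ('x \<Rightarrow> 'x) \<Rightarrow> 'x \<Rightarrow> 'x" where
  "cmin f g = (\<lambda>x\<in>S. if r (f x) (g x) then f x else g x)"

text \<open>Injectivity is automatic: if \<open>f x = f y\<close>, reflexivity and the order
  equivalence give \<open>r x y\<close> and \<open>r y x\<close>.\<close>

lemma AutI:
  assumes "f \<in> extensional S" "f ` S = S"
    and "\<And>x y. \<lbrakk>x \<in> S; y \<in> S\<rbrakk> \<Longrightarrow> r (f x) (f y) \<longleftrightarrow> r x y"
  shows "f \<in> carrier Aut"
proof -
  have "inj_on f S" 
    by (rule inj_onI) (use assms refl antisym in metis)
  then show ?thesis using assms by (auto simp: Aut_chain_def Bij_def bij_betw_def)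
qed

lemma Aut_ext: "f \<in> carrier Aut \<Longrightarrow> f \<in> extensional S"
  and Aut_image: "f \<in> carrier Aut \<Longrightarrow> f ` S = S"
  and Aut_inj: "f \<in> carrier Aut \<Longrightarrow> inj_on f S"
  and Aut_mem: "\<lbrakk>f \<in> carrier Aut; x \<in> S\<rbrakk> \<Longrightarrow> f x \<in> S"
  by (auto simp: Aut_chain_def Bij_def bij_betw_def)

text \<open>\<open>Aut_chain\<close> asks only for monotone bijections. On a chain these also
  reflect the order: otherwise \<open>y\<close> is below \<open>x\<close>, monotonicity makes the
  images equal, and injectivity gives a contradiction.\<close>

lemma Aut_le_iff:
  assumes f: "f \<in> carrier Aut" and c: "x \<in> S" "y \<in> S"
  shows "r (f x) (f y) \<longleftrightarrow> r x y"
proof -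
  have mono: "\<And>x y. \<lbrakk>x \<in> S; y \<in> S; r x y\<rbrakk> \<Longrightarrow> r (f x) (f y)"
    using f by (simp add: Aut_chain_def)
  show ?thesis
  proof
    assume r: "r (f x) (f y)"
    show "r x y"
    proof (rule ccontr)
      assume n: "\<not> r x y"
      then have "f y = f x" using antisym[of "f y" "f x"] mono[of y x] r total[of x y] c Aut_mem[OF f]
        by blast
      then have "y = x" using Aut_inj[OF f] c by (meson inj_onD)
      then show False using n refl c by blast
    qed
  qed (use mono c in blast)
qed

lemma Aut_simps [simp]:
  "\<one>\<^bsub>Aut\<^esub> = (\<lambda>x\<in>S. x)"
  "f \<otimes>\<^bsub>Aut\<^esub> g = compose S g f"
  "f \<preceq>\<^bsub>Aut\<^esub> g \<longleftrightarrow> (\<forall>x\<in>S. r (f x) (g x))"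
  by (simp_all add: Aut_chain_def)

lemma Aut_eqI:
  "\<lbrakk>f \<in> carrier Aut; g \<in> carrier Aut; \<And>x. x \<in> S \<Longrightarrow> f x = g x\<rbrakk> \<Longrightarrow> f = g"
  by (rule extensionalityI[OF Aut_ext Aut_ext])

lemma group_Aut: "group Aut"
proof (rule groupI)
  show "x \<otimes>\<^bsub>Aut\<^esub> y \<in> carrier Aut" if "x \<in> carrier Aut" "y \<in> carrier Aut" for x y
  proof (rule AutI)
    show "(x \<otimes>\<^bsub>Aut\<^esub> y) ` S = S"
    proof -
      have "(x \<otimes>\<^bsub>Aut\<^esub> y) ` S = y ` x ` S"
        by (simp add: compose_def image_image cong: image_cong_simp)
      then show ?thesis using that by (simp add: Aut_image)
    qed
  qed (use that in \<open>simp_all add: compose_def Aut_le_iff Aut_mem\<close>)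
  show "\<one>\<^bsub>Aut\<^esub> \<in> carrier Aut" by (rule AutI) auto
  show "\<one>\<^bsub>Aut\<^esub> \<otimes>\<^bsub>Aut\<^esub> x = x" if "x \<in> carrier Aut" for x
    using Aut_ext[OF that] Aut_mem[OF that] by (auto simp: compose_def extensional_def fun_eq_iff)
  show "x \<otimes>\<^bsub>Aut\<^esub> y \<otimes>\<^bsub>Aut\<^esub> z = x \<otimes>\<^bsub>Aut\<^esub> (y \<otimes>\<^bsub>Aut\<^esub> z)"
    if "x \<in> carrier Aut" "y \<in> carrier Aut" "z \<in> carrier Aut" for x y z
    using that by (auto simp: compose_def Aut_mem fun_eq_iff)
  fix f assume f: "f \<in> carrier Aut"
  have b: "bij_betw f S S" using Aut_inj[OF f] Aut_image[OF f] by (simp add: bij_betw_def)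
  let ?g = "\<lambda>x\<in>S. inv_into S f x"
  have inv: "f (inv_into S f x) = x" "inv_into S f x \<in> S" if "x \<in> S" for x
    using b that by (auto simp: bij_betw_def f_inv_into_f inv_into_into)
  have "?g \<in> carrier Aut"
  proof (rule AutI)
    show "?g ` S = S" using bij_betw_inv_into[OF b] by (simp add: bij_betw_def)
    show "r (?g x) (?g y) \<longleftrightarrow> r x y" if "x \<in> S" "y \<in> S" for x y
      using that Aut_le_iff[OF f, of "inv_into S f x" "inv_into S f y"] inv by simp
  qed simp
  moreover have "?g \<otimes>\<^bsub>Aut\<^esub> f = \<one>\<^bsub>Aut\<^esub>" using inv by (auto simp: compose_def)
  ultimately show "\<exists>g\<in>carrier Aut. g \<otimes>\<^bsub>Aut\<^esub> f = \<one>\<^bsub>Aut\<^esub>" by blast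
qed

lemma po_group_Aut: "po_group Aut"
proof (intro po_group.intro group_Aut po_group_axioms.intro)
  show "partial_order (order_of Aut)"
  proof unfold_locales
    fix x y assume "x \<sqsubseteq>\<^bsub>order_of Aut\<^esub> y" "y \<sqsubseteq>\<^bsub>order_of Aut\<^esub> x"
      "x \<in> carrier (order_of Aut)" "y \<in> carrier (order_of Aut)"
    then show "x .=\<^bsub>order_of Aut\<^esub> y" using antisym Aut_mem by (auto intro!: Aut_eqI)
  next
    fix x y z assume "x \<sqsubseteq>\<^bsub>order_of Aut\<^esub> y" "y \<sqsubseteq>\<^bsub>order_of Aut\<^esub> z"
      "x \<in> carrier (order_of Aut)" "y \<in> carrier (order_of Aut)" "z \<in> carrier (order_of Aut)"
    then show "x \<sqsubseteq>\<^bsub>order_of Aut\<^esub> z" by simp (metis Aut_mem trans)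
  qed (auto simp: refl Aut_mem fun_eq_iff)
qed (simp add: compose_def Aut_le_iff Aut_mem)

section \<open>Pointwise maxima and minima as joins and meets\<close>

lemma cmax_apply: "x \<in> S \<Longrightarrow> cmax f g x = (if r (f x) (g x) then g x else f x)"
  and cmin_apply: "x \<in> S \<Longrightarrow> cmin f g x = (if r (f x) (g x) then f x else g x)"
  by (simp_all add: cmax_def cmin_def)

text \<open>Surjectivity is the delicate point. If \<open>f u = y\<close> and
  \<open>g v = y\<close>, the maximum takes the value \<open>y\<close> at the smaller of
  \<open>u\<close> and \<open>v\<close>, the minimum at the larger.\<close>

lemma cmax_Aut:
  assumes f: "f \<in> carrier Aut" and g: "g \<in> carrier Aut"
  shows "cmax f g \<in> carrier Aut" and "cmin f g \<in> carrier Aut"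
proof -
  note [simp] = Aut_mem[OF f] Aut_mem[OF g]
  note le = Aut_le_iff[OF f] Aut_le_iff[OF g]
  have inv: "\<exists>x\<in>S. \<exists>x'\<in>S. f x = y \<and> g x' = y" if "y \<in> S" for y
    using Aut_image[OF f] Aut_image[OF g] that by (metis imageE)
  show "cmax f g \<in> carrier Aut"
  proof (rule AutI)
    show "cmax f g ` S = S"
    proof
      show "cmax f g ` S \<subseteq> S" by (auto simp: cmax_def)
      show "S \<subseteq> cmax f g ` S"
      proof
        fix y assume y: "y \<in> S"
        obtain u v where uv: "u \<in> S" "v \<in> S" "f u = y" "g v = y" using inv[OF y] by blast
        show "y \<in> cmax f g ` S"
        proof (cases "r u v")
          case True
          then have "r (g u) (f u)" using uv le by metis
          then have "cmax f g u = y" using uv antisym[of "f u" "g u"] by (auto simp: cmax_apply)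
          then show ?thesis using uv by blast
        next
          case False
          then have "r (f v) (g v)" using uv le total by metis
          then have "cmax f g v = y" using uv by (auto simp: cmax_apply)
          then show ?thesis using uv by blast
        qed
      qed
    qed
    show "r (cmax f g x) (cmax f g y) \<longleftrightarrow> r x y" if c: "x \<in> S" "y \<in> S" for x y
    proof -
      have *: "r (cmax f g x) (cmax f g y)" if "r x y" "x \<in> S" "y \<in> S" for x y
        using that le[of x y] total[of "f x" "g x"] total[of "f y" "g y"]
          trans[of "f x" "f y" "g y"] trans[of "g x" "g y" "f y"]
        by (auto simp: cmax_apply)
      \<comment> \<open>The common value bounds both \<open>f x\<close> and \<open>g x\<close> from
        above and equals \<open>f y\<close> or \<open>g y\<close>; whichever of \<open>f\<close>,
        \<open>g\<close> it is then reflects the comparison to \<open>r x y\<close>.\<close>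
      have **: "x = y" if "cmax f g x = cmax f g y" "r y x" "x \<in> S" "y \<in> S" for x y
      proof -
        let ?m = "cmax f g y"
        have "r (f x) ?m" "r (g x) ?m"
          using that(1,3,4) total[of "f x" "g x"] refl unfolding that(1)[symmetric]
          by (auto simp: cmax_apply)
        moreover have "?m = f y \<or> ?m = g y" using that(4) by (auto simp: cmax_apply)
        ultimately have "r x y" using le that by metis
        then show ?thesis using antisym that by blast
      qed
      have m: "cmax f g x \<in> S" "cmax f g y \<in> S" using c by (auto simp: cmax_apply)
      show ?thesis
        using * ** antisym[OF m] total[OF c] refl c by metis
    qed
  qed (simp add: cmax_def)
  show "cmin f g \<in> carrier Aut"
  proof (rule AutI)
    show "cmin f g ` S = S"
    proof
      show "cmin f g ` S \<subseteq> S" by (auto simp: cmin_def)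
      show "S \<subseteq> cmin f g ` S"
      proof
        fix y assume y: "y \<in> S"
        obtain u v where uv: "u \<in> S" "v \<in> S" "f u = y" "g v = y" using inv[OF y] by blast
        show "y \<in> cmin f g ` S"
        proof (cases "r u v")
          case True
          then have "r (f v) (f v)" "r (g v) (f v)" using uv le refl by metis+
          then have "cmin f g v = y" using uv antisym[of "f v" "g v"] by (auto simp: cmin_apply)
          then show ?thesis using uv by blast
        next
          case False
          then have "r (f u) (g u)" using uv le total by metis
          then have "cmin f g u = y" using uv by (auto simp: cmin_apply)
          then show ?thesis using uv by blast
        qed
      qed
    qed
    show "r (cmin f g x) (cmin f g y) \<longleftrightarrow> r x y" if c: "x \<in> S" "y \<in> S" for x y
    proof -
      have *: "r (cmin f g x) (cmin f g y)" if "r x y" "x \<in> S" "y \<in> S" for x y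
        using that le[of x y] total[of "f x" "g x"] total[of "f y" "g y"]
          trans[of "f x" "g x" "g y"] trans[of "g x" "f x" "f y"]
        by (auto simp: cmin_apply)
      have **: "x = y" if "cmin f g x = cmin f g y" "r y x" "x \<in> S" "y \<in> S" for x y
      proof -
        let ?m = "cmin f g x"
        have "r ?m (f y)" "r ?m (g y)"
          using that(3,4) total[of "f y" "g y"] refl unfolding that(1)
          by (auto simp: cmin_apply)
        moreover have "?m = f x \<or> ?m = g x" using that(3) by (auto simp: cmin_apply)
        ultimately have "r x y" using le that by metis
        then show ?thesis using antisym that by blast
      qed
      have m: "cmin f g x \<in> S" "cmin f g y \<in> S" using c by (auto simp: cmin_apply)
      show ?thesis
        using * ** antisym[OF m] total[OF c] refl c by metis
    qed
  qed (simp add: cmin_def)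
qed

lemma cmax_lub:
  assumes f: "f \<in> carrier Aut" and g: "g \<in> carrier Aut"
  shows "f \<preceq>\<^bsub>Aut\<^esub> cmax f g" "g \<preceq>\<^bsub>Aut\<^esub> cmax f g"
    and "\<lbrakk>f \<preceq>\<^bsub>Aut\<^esub> k; g \<preceq>\<^bsub>Aut\<^esub> k\<rbrakk> \<Longrightarrow> cmax f g \<preceq>\<^bsub>Aut\<^esub> k"
  using refl Aut_mem[OF f] Aut_mem[OF g] by (simp_all add: cmax_apply) (metis total)

lemma cmin_glb:
  assumes f: "f \<in> carrier Aut" and g: "g \<in> carrier Aut"
  shows "cmin f g \<preceq>\<^bsub>Aut\<^esub> f" "cmin f g \<preceq>\<^bsub>Aut\<^esub> g"
    and "\<lbrakk>k \<preceq>\<^bsub>Aut\<^esub> f; k \<preceq>\<^bsub>Aut\<^esub> g\<rbrakk> \<Longrightarrow> k \<preceq>\<^bsub>Aut\<^esub> cmin f g"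
  using refl Aut_mem[OF f] Aut_mem[OF g] by (simp_all add: cmin_apply) (metis total)

lemma l_group_Aut: "l_group Aut"
proof -
  interpret po_group Aut by (rule po_group_Aut)
  show ?thesis
  proof (rule l_groupI)
    fix x y assume c: "x \<in> carrier Aut" "y \<in> carrier Aut"
    show "\<exists>z\<in>carrier Aut. x \<preceq>\<^bsub>Aut\<^esub> z \<and> y \<preceq>\<^bsub>Aut\<^esub> z \<and>
        (\<forall>w\<in>carrier Aut. x \<preceq>\<^bsub>Aut\<^esub> w \<longrightarrow> y \<preceq>\<^bsub>Aut\<^esub> w \<longrightarrow> z \<preceq>\<^bsub>Aut\<^esub> w)"
      using cmax_Aut(1)[OF c] cmax_lub[OF c] by blast
    show "\<exists>z\<in>carrier Aut. z \<preceq>\<^bsub>Aut\<^esub> x \<and> z \<preceq>\<^bsub>Aut\<^esub> y \<and>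
        (\<forall>w\<in>carrier Aut. w \<preceq>\<^bsub>Aut\<^esub> x \<longrightarrow> w \<preceq>\<^bsub>Aut\<^esub> y \<longrightarrow> w \<preceq>\<^bsub>Aut\<^esub> z)"
      using cmax_Aut(2)[OF c] cmin_glb[OF c] by blast
  qed
qed

lemma ojoin_Aut:
  assumes f: "f \<in> carrier Aut" and g: "g \<in> carrier Aut"
  shows "ojoin Aut f g = cmax f g"
proof -
  interpret po_group Aut by (rule po_group_Aut)
  show ?thesis by (rule ojoin_eqI) (rule f g cmax_Aut cmax_lub; assumption?)+
qed

lemma omeet_Aut:
  assumes f: "f \<in> carrier Aut" and g: "g \<in> carrier Aut"
  shows "omeet Aut f g = cmin f g"
proof -
  interpret po_group Aut by (rule po_group_Aut)
  show ?thesis by (rule omeet_eqI) (rule f g cmax_Aut cmin_glb; assumption?)+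
qed

section \<open>Stabilizers of points\<close>

lemma stabilizer_prime:
  assumes F: "l_group F" and h: "l_hom F Aut h" and x0: "x0 \<in> S"
    and nontriv: "\<exists>x\<in>carrier F. h x x0 \<noteq> x0"
  shows "prime_subgroup {x \<in> carrier F. h x x0 = x0} F" (is "prime_subgroup ?K F")
    and "\<lbrakk>x \<in> carrier F; y \<in> carrier F\<rbrakk> \<Longrightarrow>
      coset_below F {x \<in> carrier F. h x x0 = x0} x y \<longleftrightarrow> r (h x x0) (h y x0)"
proof -
  interpret F: l_group F by (rule F)
  interpret A: l_group Aut by (rule l_group_Aut)
  interpret h: group_hom F Aut h using h by unfold_locales (simp add: l_hom_def)
  \<comment> \<open>The product of \<open>Aut\<close> applies its left factor first, so
    \<open>h\<close> is a right action on \<open>S\<close>, which matches right cosets of the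
    stabilizer.\<close>
  have hm: "h (x \<otimes>\<^bsub>F\<^esub> y) x0 = h y (h x x0)" if "x \<in> carrier F" "y \<in> carrier F" for x y
    using that x0 by (simp add: compose_def)
  have hj: "h (ojoin F x y) x0 = (if r (h x x0) (h y x0) then h y x0 else h x x0)"
    and hme: "h (omeet F x y) x0 = (if r (h x x0) (h y x0) then h x x0 else h y x0)"
    if "x \<in> carrier F" "y \<in> carrier F" for x y
    using that x0 h by (simp_all add: l_hom_def ojoin_Aut omeet_Aut cmax_apply cmin_apply)
  have hin: "h x z \<in> S" if "x \<in> carrier F" "z \<in> S" for x z
    using that Aut_mem by simp
  have h1: "h \<one>\<^bsub>F\<^esub> x0 = x0" using x0 by simp
  have hi: "h (inv\<^bsub>F\<^esub> x) (h x x0) = x0" if "x \<in> carrier F" for x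
    using hm[of x "inv\<^bsub>F\<^esub> x"] h1 that by simp
  have mono: "r (h x x0) (h y x0)" if "x \<preceq>\<^bsub>F\<^esub> y" "x \<in> carrier F" "y \<in> carrier F" for x y
  proof -
    \<comment> \<open>\<open>l_hom\<close> records only joins and meets; monotonicity is recovered
      from the join of comparable elements.\<close>
    have "ojoin F x y = y" using that by (intro F.ojoin_eqI) auto
    then have "h y x0 = (if r (h x x0) (h y x0) then h y x0 else h x x0)" using hj[of x y] that by simp
    then show ?thesis using refl[OF hin[OF that(3) x0]] by (auto split: if_splits)
  qed
  have S: "subgroup ?K F"
  proof (rule F.subgroupI)
    show "inv\<^bsub>F\<^esub> a \<in> ?K" if "a \<in> ?K" for a using hi[of a] that by simp
    show "a \<otimes>\<^bsub>F\<^esub> b \<in> ?K" if "a \<in> ?K" "b \<in> ?K" for a b using hm[of a b] that by simp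
  qed (use h1 in auto)
  have conv: "convex_l_subgroup ?K F"
    unfolding convex_l_subgroup_def l_subgroup_def
  proof (intro conjI S ballI impI)
    fix x y z assume c: "x \<in> ?K" "z \<in> ?K" "y \<in> carrier F" "x \<preceq>\<^bsub>F\<^esub> y \<and> y \<preceq>\<^bsub>F\<^esub> z"
    then show "y \<in> ?K" using mono[of x y] mono[of y z] antisym[of x0 "h y x0"] hin[of y x0] x0 by simp
  qed (auto simp: hj hme)
  define K where "K = ?K"
  have memK: "x \<in> K \<longleftrightarrow> x \<in> carrier F \<and> h x x0 = x0" for x by (simp add: K_def)
  interpret K: convex_in_l_group F K by unfold_locales (use conv K_def in simp)
  have *: "coset_below F K x y \<longleftrightarrow> r (h x x0) (h y x0)"
    if c: "x \<in> carrier F" "y \<in> carrier F" for x y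
  proof
    assume "coset_below F K x y"
    then obtain t where t: "t \<in> K" "x \<preceq>\<^bsub>F\<^esub> t \<otimes>\<^bsub>F\<^esub> y"
      unfolding coset_below_def by (rule bexE)
    then have "h (t \<otimes>\<^bsub>F\<^esub> y) x0 = h y x0" using hm[of t y] c by (simp add: memK)
    then show "r (h x x0) (h y x0)" using mono[OF t(2)] t(1) c by (metis F.m_closed memK)
  next
    assume r: "r (h x x0) (h y x0)"
    \<comment> \<open>When \<open>x\<close> moves \<open>x0\<close> no further than \<open>y\<close>
      does, the join moves \<open>x0\<close> exactly as \<open>y\<close> does, so following it by
      the inverse of \<open>y\<close> fixes \<open>x0\<close>. Multiplying back by \<open>y\<close>
      gives the join, which dominates \<open>x\<close>.\<close>
    let ?t = "ojoin F x y \<otimes>\<^bsub>F\<^esub> inv\<^bsub>F\<^esub> y"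
    have "h ?t x0 = x0" using c r hm[of "ojoin F x y" "inv\<^bsub>F\<^esub> y"] hj[of x y] hi[of y] by simp
    then have "?t \<in> K" using c memK by simp
    moreover have "x \<preceq>\<^bsub>F\<^esub> ?t \<otimes>\<^bsub>F\<^esub> y" using c F.ojoin_left by (simp add: F.m_assoc)
    ultimately show "coset_below F K x y" unfolding coset_below_def by (rule bexI[rotated])
  qed
  have "prime_subgroup K F"
    unfolding K.prime_iff_below_total
  proof (intro conjI ballI)
    show "K \<noteq> carrier F" using nontriv memK by blast
    show "K.below x y \<or> K.below y x" if "x \<in> carrier F" "y \<in> carrier F" for x y
      unfolding *[OF that] *[OF that(2,1)] by (rule total[OF hin[OF that(1) x0] hin[OF that(2) x0]])
  qed
  then show "prime_subgroup ?K F" unfolding K_def .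
  show "coset_below F ?K x y \<longleftrightarrow> r (h x x0) (h y x0)" if "x \<in> carrier F" "y \<in> carrier F"
    using *[OF that] unfolding K_def .
qed

end

section \<open>The chain of a right pre-order\<close>

text \<open>Joins computed in \<open>K\<close> agree with those of \<open>H\<close>. Hence maps into
  \<open>H_of G C\<close> can be treated as maps into the full automorphism group, where joins and
  meets are pointwise.\<close>

lemma l_hom_sub_iff:
  assumes H: "l_group H" and K: "l_subgroup K H" and h: "h ` carrier F \<subseteq> K"
  shows "l_hom F (H\<lparr>carrier := K\<rparr>) h \<longleftrightarrow> l_hom F H h"
proof -
  have K': "K \<subseteq> carrier H" using K by (auto simp: l_subgroup_def dest: subgroup.subset)
  have hK: "h x \<in> K" "h x \<in> carrier H" if "x \<in> carrier F" for x using that h K' by blast+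
  have "h \<in> hom F (H\<lparr>carrier := K\<rparr>) \<longleftrightarrow> h \<in> hom F H"
    using hK by (auto simp: hom_def)
  then show ?thesis
    unfolding l_hom_def using l_group.sub_l_group(2,3)[OF H K hK(1) hK(1)] by simp
qed

lemma positive_hom_sub_iff:
  assumes K: "subgroup K H" and h: "h ` carrier F \<subseteq> K"
  shows "positive_hom F (H\<lparr>carrier := K\<rparr>) h \<longleftrightarrow> positive_hom F H h"
proof -
  have "K \<subseteq> carrier H" using K by (rule subgroup.subset)
  then have "h \<in> hom F (H\<lparr>carrier := K\<rparr>) \<longleftrightarrow> h \<in> hom F H"
    using h by (auto simp: hom_def)
  then show ?thesis by (simp add: positive_hom_def)
qed

locale po_group_precone = po_group G for G :: "('g, 'm) ogroup_scheme" (structure) +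
  fixes C :: "'g set"
  assumes C: "precone G C"
begin

abbreviation pre (infix \<open>\<sqsubseteq>\<^sub>C\<close> 50) where "a \<sqsubseteq>\<^sub>C b \<equiv> (a, b) \<in> preorder_of G C"

abbreviation cls where "cls a \<equiv> equiv_of G C `` {a}"

abbreviation "AutC \<equiv> Aut_Omega G C"

lemma right_preorder: "right_preorder G (preorder_of G C)"
  using C preorder_of_cone_of unfolding precone_def by auto

lemma pre_closed: "a \<sqsubseteq>\<^sub>C b \<Longrightarrow> a \<in> carrier G \<and> b \<in> carrier G"
  by (auto simp: preorder_of_def)

lemma pre_refl: "a \<in> carrier G \<Longrightarrow> a \<sqsubseteq>\<^sub>C a"
  using right_preorder unfolding right_preorder_def refl_on_def by blast

lemma pre_trans: "a \<sqsubseteq>\<^sub>C b \<Longrightarrow> b \<sqsubseteq>\<^sub>C c \<Longrightarrow> a \<sqsubseteq>\<^sub>C c"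
  using right_preorder unfolding right_preorder_def by (blast dest: transD)

lemma pre_total: "a \<in> carrier G \<Longrightarrow> b \<in> carrier G \<Longrightarrow> a \<sqsubseteq>\<^sub>C b \<or> b \<sqsubseteq>\<^sub>C a"
  using right_preorder pre_refl unfolding right_preorder_def total_on_def by metis

lemma pre_if_le: "a \<preceq> b \<Longrightarrow> a \<in> carrier G \<Longrightarrow> b \<in> carrier G \<Longrightarrow> a \<sqsubseteq>\<^sub>C b"
  using right_preorder unfolding right_preorder_def by blast

lemma pre_mult: "a \<sqsubseteq>\<^sub>C b \<Longrightarrow> t \<in> carrier G \<Longrightarrow> a \<otimes> t \<sqsubseteq>\<^sub>C b \<otimes> t"
  using right_preorder unfolding right_preorder_def by blast

lemma pre_mult_iff:
  assumes "a \<in> carrier G" "b \<in> carrier G" "t \<in> carrier G"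
  shows "a \<otimes> t \<sqsubseteq>\<^sub>C b \<otimes> t \<longleftrightarrow> a \<sqsubseteq>\<^sub>C b"
  using pre_mult[of a b t] pre_mult[of "a \<otimes> t" "b \<otimes> t" "inv t"] assms by (auto simp: m_assoc)

lemma mem_C_iff: "a \<in> C \<longleftrightarrow> \<one> \<sqsubseteq>\<^sub>C a"
proof -
  have "C \<subseteq> carrier G" using C by (auto simp: precone_def cone_of_def)
  then show ?thesis by (auto simp: preorder_of_def)
qed

lemma mem_cls_iff: "b \<in> cls a \<longleftrightarrow> a \<sqsubseteq>\<^sub>C b \<and> b \<sqsubseteq>\<^sub>C a"
  by (simp add: equiv_of_def)

lemma cls_eq_iff:
  assumes "a \<in> carrier G" "b \<in> carrier G"
  shows "cls a = cls b \<longleftrightarrow> a \<sqsubseteq>\<^sub>C b \<and> b \<sqsubseteq>\<^sub>C a"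
proof
  assume "cls a = cls b"
  then have "b \<in> cls a" using mem_cls_iff pre_refl assms by blast
  then show "a \<sqsubseteq>\<^sub>C b \<and> b \<sqsubseteq>\<^sub>C a" unfolding mem_cls_iff .
next
  assume "a \<sqsubseteq>\<^sub>C b \<and> b \<sqsubseteq>\<^sub>C a"
  then show "cls a = cls b" unfolding set_eq_iff mem_cls_iff by (meson pre_trans)
qed

lemma Omega_iff: "X \<in> Omega G C \<longleftrightarrow> (\<exists>a\<in>carrier G. X = cls a)"
  by (auto simp: Omega_def quotient_def)

lemma cls_Omega: "a \<in> carrier G \<Longrightarrow> cls a \<in> Omega G C"
  unfolding Omega_iff by blast

lemma Omega_le_cls:
  assumes c: "a \<in> carrier G" "b \<in> carrier G"
  shows "Omega_le G C (cls a) (cls b) \<longleftrightarrow> a \<sqsubseteq>\<^sub>C b"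
proof
  assume "Omega_le G C (cls a) (cls b)"
  then obtain a' b' where "a' \<in> carrier G" "b' \<in> carrier G" "cls a = cls a'" "cls b = cls b'"
    "a' \<sqsubseteq>\<^sub>C b'"
    unfolding Omega_le_def by blast
  then show "a \<sqsubseteq>\<^sub>C b" using cls_eq_iff c pre_trans by metis
next
  assume "a \<sqsubseteq>\<^sub>C b"
  then show "Omega_le G C (cls a) (cls b)" using c unfolding Omega_le_def by blast
qed

sublocale Om: chain_set "Omega G C" "Omega_le G C"
proof
  fix X Y Z assume "X \<in> Omega G C" "Y \<in> Omega G C" "Z \<in> Omega G C"
    "Omega_le G C X Y" "Omega_le G C Y Z"
  then show "Omega_le G C X Z"
    unfolding Omega_iff using pre_trans by (metis Omega_le_cls)
next
  fix X Y assume "X \<in> Omega G C" "Y \<in> Omega G C" "Omega_le G C X Y" "Omega_le G C Y X"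
  then show "X = Y"
    unfolding Omega_iff by (metis Omega_le_cls cls_eq_iff)
next
  fix X Y assume "X \<in> Omega G C" "Y \<in> Omega G C"
  then show "Omega_le G C X Y \<or> Omega_le G C Y X"
    unfolding Omega_iff by (metis Omega_le_cls pre_total)
next
  fix X assume "X \<in> Omega G C"
  then show "Omega_le G C X X"
    unfolding Omega_iff by (metis Omega_le_cls pre_refl)
qed

section \<open>The positive homomorphism \<open>R_map\<close> and the l-group it generates\<close>

lemma l_group_Aut_Omega: "l_group AutC"
  unfolding Aut_Omega_def by (rule Om.l_group_Aut)

lemma R_map_cls:
  assumes c: "a \<in> carrier G" "b \<in> carrier G"
  shows "R_map G C a (cls b) = cls (b \<otimes> a)"
proof -
  \<comment> \<open>Right invariance of the pre-order makes all members of the union in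
    \<open>R_map\<close> equal.\<close>
  have "cls (b' \<otimes> a) = cls (b \<otimes> a)" if "b' \<in> cls b" for b'
    using that c pre_mult pre_closed unfolding mem_cls_iff by (subst cls_eq_iff) auto
  moreover have "b \<in> cls b" using c mem_cls_iff pre_refl by blast
  ultimately have "(\<Union>b'\<in>cls b. cls (b' \<otimes> a)) = cls (b \<otimes> a)" by blast
  then show ?thesis using cls_Omega[OF c(2)] unfolding R_map_def by (simp only: restrict_apply')
qed

lemma R_map_Aut:
  assumes a: "a \<in> carrier G"
  shows "R_map G C a \<in> carrier AutC"
  unfolding Aut_Omega_def
proof (rule Om.AutI)
  show "R_map G C a \<in> extensional (Omega G C)" by (simp add: R_map_def)
  show "R_map G C a ` Omega G C = Omega G C"
  proof
    show "R_map G C a ` Omega G C \<subseteq> Omega G C"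
    proof (rule image_subsetI)
      fix X assume "X \<in> Omega G C"
      then obtain b where b: "b \<in> carrier G" "X = cls b" unfolding Omega_iff by blast
      show "R_map G C a X \<in> Omega G C"
        unfolding b(2) R_map_cls[OF a b(1)] using a b(1) by (intro cls_Omega m_closed)
    qed
    show "Omega G C \<subseteq> R_map G C a ` Omega G C"
    proof
      fix X assume "X \<in> Omega G C"
      then obtain b where b: "b \<in> carrier G" "X = cls b" unfolding Omega_iff by blast
      have "X = R_map G C a (cls (b \<otimes> inv a))"
        using a b(1) by (subst R_map_cls) (simp_all add: b(2) m_assoc)
      then show "X \<in> R_map G C a ` Omega G C" using cls_Omega[of "b \<otimes> inv a"] a b by blast
    qed
  qed
  show "Omega_le G C (R_map G C a X) (R_map G C a Y) \<longleftrightarrow> Omega_le G C X Y"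
    if XY: "X \<in> Omega G C" "Y \<in> Omega G C" for X Y
  proof -
    obtain b c where "b \<in> carrier G" "X = cls b" "c \<in> carrier G" "Y = cls c"
      using XY unfolding Omega_iff by blast
    then show ?thesis using a by (simp add: R_map_cls Omega_le_cls pre_mult_iff)
  qed
qed

lemma R_map_positive_hom: "positive_hom G AutC (R_map G C)"
  unfolding positive_hom_def
proof (intro conjI ballI impI homI)
  fix a b assume c: "a \<in> carrier G" "b \<in> carrier G"
  show "R_map G C (a \<otimes> b) = R_map G C a \<otimes>\<^bsub>AutC\<^esub> R_map G C b"
    unfolding Aut_Omega_def
  proof (rule Om.Aut_eqI)
    fix X assume "X \<in> Omega G C"
    then obtain d where d: "d \<in> carrier G" "X = cls d" unfolding Omega_iff by blast
    then show "R_map G C (a \<otimes> b) X = (R_map G C a \<otimes>\<^bsub>Om.Aut\<^esub> R_map G C b) X"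
      using c by (simp add: R_map_cls compose_def cls_Omega m_assoc)
  qed (use R_map_Aut c monoid.m_closed[OF group.is_monoid[OF Om.group_Aut]]
      in \<open>simp_all add: Aut_Omega_def del: Om.Aut_simps\<close>)
next
  fix a b assume c: "a \<in> carrier G" "b \<in> carrier G" "a \<preceq> b"
  have "Omega_le G C (R_map G C a X) (R_map G C b X)" if X: "X \<in> Omega G C" for X
  proof -
    obtain d where d: "d \<in> carrier G" "X = cls d" using X unfolding Omega_iff by blast
    \<comment> \<open>The pre-order is only right invariant. The left factor \<open>d\<close> is
      therefore multiplied on in the two-sided partial order of \<open>G\<close>, and the result is
      then passed to the pre-order extending it.\<close>
    then show ?thesis
      using c mult_left_mono[of a b d] by (simp add: R_map_cls Omega_le_cls pre_if_le)
  qed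
  then show "R_map G C a \<preceq>\<^bsub>AutC\<^esub> R_map G C b" by (simp add: Aut_Omega_def)
qed (rule R_map_Aut)

lemma R_map_image: "R_map G C ` carrier G \<subseteq> carrier AutC"
  using R_map_Aut by blast

lemma l_subgroup_H: "l_subgroup (carrier (H_of G C)) AutC"
  using l_group.l_subgroup_l_generated[OF l_group_Aut_Omega R_map_image] by (simp add: H_of_def)

lemma H_of_eq: "H_of G C = AutC\<lparr>carrier := carrier (H_of G C)\<rparr>"
  by (simp add: H_of_def)

lemma l_group_H: "l_group (H_of G C)"
  using l_group.sub_l_group(1)[OF l_group_Aut_Omega l_subgroup_H] H_of_eq by simp

lemma R_map_H: "R_map G C ` carrier G \<subseteq> carrier (H_of G C)"
  using l_group.l_generated_incl[OF l_group_Aut_Omega] by (simp add: H_of_def)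

lemma R_map_positive_hom_H: "positive_hom G (H_of G C) (R_map G C)"
proof -
  have "subgroup (carrier (H_of G C)) AutC" using l_subgroup_H by (simp add: l_subgroup_def)
  from positive_hom_sub_iff[OF this R_map_H] show ?thesis
    using R_map_positive_hom H_of_eq by simp
qed

lemma l_hom_H_iff:
  "h ` carrier F \<subseteq> carrier (H_of G C) \<Longrightarrow> l_hom F (H_of G C) h \<longleftrightarrow> l_hom F AutC h"
  using l_hom_sub_iff[OF l_group_Aut_Omega l_subgroup_H] H_of_eq by metis

lemma l_hom_H_image: "l_hom F (H_of G C) h \<Longrightarrow> h ` carrier F \<subseteq> carrier (H_of G C)"
  by (auto simp: l_hom_def hom_def)

end

section \<open>Primes of the free object\<close>

locale free_l_group_over = G: po_group G
  for G :: "'g ogroup" and F :: "'f ogroup" and \<eta> :: "'g \<Rightarrow> 'f" and V :: variety +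
  assumes free_F: "free_l_group TYPE('f) V G F \<eta>"
    and free_Omega: "free_l_group TYPE('g set \<Rightarrow> 'g set) V G F \<eta>"
begin

lemma F_in_V: "in_variety V F"
  using free_F by (simp add: free_l_group_def)

sublocale F: l_group F
  using F_in_V by (simp add: in_variety_def)

lemma eta_positive: "positive_hom G F \<eta>"
  using free_F by (simp add: free_l_group_def)

sublocale eta: group_hom G F \<eta>
  using eta_positive by unfold_locales (simp add: positive_hom_def)

text \<open>The lattice span \<open>K\<close> is an l-subgroup, so it lies in the variety and
  receives an l-homomorphism \<open>h\<close> from \<open>F\<close> extending \<open>\<eta>\<close>.
  Read as an endomorphism of \<open>F\<close>, \<open>h\<close> agrees with the identity on the
  image of \<open>\<eta>\<close>; uniqueness, with \<open>F\<close> as test object, makes it the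
  identity, so \<open>F\<close> is contained in \<open>K\<close>.\<close>

lemma carrier_F: "carrier F = lattice_span F (\<eta> ` carrier G)"
proof -
  let ?A = "\<eta> ` carrier G"
  have A: "subgroup ?A F" by (rule eta.img_is_subgroup)
  define K where "K = lattice_span F ?A"
  have K: "l_subgroup K F" using F.l_subgroup_lattice_span[OF A] by (simp add: K_def)
  have KF: "K \<subseteq> carrier F" using K by (auto simp: l_subgroup_def dest: subgroup.subset)
  have AK: "?A \<subseteq> K" by (auto simp: K_def intro: lattice_span.incl)
  let ?FK = "F\<lparr>carrier := K\<rparr>"
  have "positive_hom G ?FK \<eta>"
    using positive_hom_sub_iff[of K F \<eta> G] K AK eta_positive by (simp add: l_subgroup_def)
  then obtain h where h: "h \<in> extensional (carrier F)" "l_hom F ?FK h" "\<forall>a\<in>carrier G. h (\<eta> a) = \<eta> a"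
    using free_F F.in_variety_sub[OF F_in_V K]
    unfolding free_l_group_def universal_in_def by blast
  have hK: "h ` carrier F \<subseteq> K" using h(2) by (auto simp: l_hom_def hom_def)
  then have h': "l_hom F F h" using h(2) l_hom_sub_iff[OF F.l_group_axioms K hK] by simp
  let ?id = "\<lambda>x\<in>carrier F. x"
  have "l_hom F F ?id" by (auto simp: l_hom_def hom_def)
  moreover have "\<exists>!h. h \<in> extensional (carrier F) \<and> l_hom F F h \<and> (\<forall>a\<in>carrier G. h (\<eta> a) = \<eta> a)"
    using free_F unfolding free_l_group_def universal_in_def by blast
  ultimately have "h = ?id"
    using h(1,3) h' by (metis (no_types, lifting) eta.hom_closed restrict_apply' restrict_extensional)
  then have "carrier F \<subseteq> K" using hK by auto
  then show ?thesis using KF by (simp add: K_def)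
qed

text \<open>Without cases for products and inverses, this applies to properties that are controlled
  only under joins and meets, such as strict positivity modulo a prime.\<close>

lemma F_induct [consumes 1, case_names eta join meet]:
  assumes x: "x \<in> carrier F"
    and eta: "\<And>a. a \<in> carrier G \<Longrightarrow> Q (\<eta> a)"
    and join: "\<And>x y. \<lbrakk>x \<in> carrier F; y \<in> carrier F; Q x; Q y\<rbrakk> \<Longrightarrow> Q (ojoin F x y)"
    and meet: "\<And>x y. \<lbrakk>x \<in> carrier F; y \<in> carrier F; Q x; Q y\<rbrakk> \<Longrightarrow> Q (omeet F x y)"
  shows "Q x"
proof -
  have "x \<in> lattice_span F (\<eta> ` carrier G)" using x carrier_F by simp
  then have "x \<in> carrier F \<and> Q x"
  proof induction
    case (incl x)
    then show ?case using eta by auto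
  next
    case (join x y)
    then show ?case using assms(3) by simp
  next
    case (meet x y)
    then show ?case using assms(4) by simp
  qed
  then show ?thesis ..
qed

lemma eta_le: "\<lbrakk>a \<preceq>\<^bsub>G\<^esub> b; a \<in> carrier G; b \<in> carrier G\<rbrakk> \<Longrightarrow> \<eta> a \<preceq>\<^bsub>F\<^esub> \<eta> b"
  using eta_positive by (simp add: positive_hom_def)

lemma precone_PV: "C \<in> PV V G \<Longrightarrow> po_group_precone G C"
  by unfold_locales (simp add: PV_def)

lemma h_of_unique:
  assumes C: "C \<in> PV V G"
  shows "\<exists>!h. h \<in> extensional (carrier F) \<and> l_hom F (H_of G C) h \<and>
    (\<forall>a\<in>carrier G. h (\<eta> a) = R_map G C a)"
proof -
  interpret C: po_group_precone G C by (rule precone_PV[OF C])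
  have "in_variety V (H_of G C)" using C by (simp add: PV_def)
  then show ?thesis
    using free_Omega C.R_map_positive_hom_H unfolding free_l_group_def universal_in_def by blast
qed

lemma h_of:
  assumes C: "C \<in> PV V G"
  shows h_of_l_hom: "l_hom F (H_of G C) (h_of G F \<eta> C)"
    and h_of_eta: "a \<in> carrier G \<Longrightarrow> h_of G F \<eta> C (\<eta> a) = R_map G C a"
  using theI'[OF h_of_unique[OF C], folded h_of_def] by blast+

lemma h_of_eqI:
  assumes C: "C \<in> PV V G" and "h \<in> extensional (carrier F)" "l_hom F (H_of G C) h"
    "\<And>a. a \<in> carrier G \<Longrightarrow> h (\<eta> a) = R_map G C a"
  shows "h_of G F \<eta> C = h"
  unfolding h_of_def by (rule the1_equality[OF h_of_unique[OF C]]) (use assms in blast)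

abbreviation cl :: "'g set \<Rightarrow> 'g \<Rightarrow> 'g set" where "cl C a \<equiv> equiv_of G C `` {a}"

abbreviation base :: "'g set \<Rightarrow> 'g set" where "base C \<equiv> cl C \<one>\<^bsub>G\<^esub>"

lemma h_of_Aut:
  assumes C: "C \<in> PV V G"
  shows "l_hom F (Aut_Omega G C) (h_of G F \<eta> C)"
proof -
  interpret C: po_group_precone G C by (rule precone_PV[OF C])
  show ?thesis using h_of_l_hom[OF C] C.l_hom_H_iff[OF C.l_hom_H_image[OF h_of_l_hom[OF C]]] by blast
qed

lemma kappa_eq:
  assumes C: "C \<in> PV V G"
  shows "kappa G F \<eta> C = {x \<in> carrier F. h_of G F \<eta> C x (base C) = base C}"
  using po_group_precone.l_hom_H_image[OF precone_PV[OF C] h_of_l_hom[OF C]]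
  by (auto simp: kappa_def)

lemma h_of_eta_base:
  assumes C: "C \<in> PV V G" and a: "a \<in> carrier G"
  shows "h_of G F \<eta> C (\<eta> a) (base C) = cl C a"
  using po_group_precone.R_map_cls[OF precone_PV[OF C] a G.one_closed] a h_of_eta[OF C a] by simp

section \<open>From pre-cones to primes and back\<close>

lemma kappa_prime:
  assumes C: "C \<in> PV V G"
  shows "kappa G F \<eta> C \<in> Spec F"
    and "\<lbrakk>x \<in> carrier F; y \<in> carrier F\<rbrakk> \<Longrightarrow> coset_below F (kappa G F \<eta> C) x y \<longleftrightarrow>
      Omega_le G C (h_of G F \<eta> C x (base C)) (h_of G F \<eta> C y (base C))"
proof -
  interpret C: po_group_precone G C by (rule precone_PV[OF C])
  \<comment> \<open>A pre-cone is proper; an element outside it moves the class of the identity,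
    which gives the nontriviality that \<open>stabilizer_prime\<close> asks for.\<close>
  have "\<exists>a\<in>carrier G. \<not> \<one>\<^bsub>G\<^esub> \<sqsubseteq>\<^sub>C a"
    using C.C C.mem_C_iff unfolding G.precone_iff by blast
  then obtain a where a: "a \<in> carrier G" "\<not> \<one>\<^bsub>G\<^esub> \<sqsubseteq>\<^sub>C a" by blast
  then have "cl C a \<noteq> base C" using C.cls_eq_iff[of a "\<one>\<^bsub>G\<^esub>"] by blast
  then have "\<exists>x\<in>carrier F. h_of G F \<eta> C x (base C) \<noteq> base C"
    using h_of_eta_base[OF C a(1)] eta.hom_closed[OF a(1)] by metis
  note st = C.Om.stabilizer_prime[OF F.l_group_axioms h_of_Aut[OF C, unfolded Aut_Omega_def]
      C.cls_Omega[OF G.one_closed] this]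
  show "kappa G F \<eta> C \<in> Spec F" unfolding Spec_def kappa_eq[OF C] using st(1) by (rule CollectI)
  show "\<lbrakk>x \<in> carrier F; y \<in> carrier F\<rbrakk> \<Longrightarrow> coset_below F (kappa G F \<eta> C) x y \<longleftrightarrow>
      Omega_le G C (h_of G F \<eta> C x (base C)) (h_of G F \<eta> C y (base C))"
    unfolding kappa_eq[OF C] by (rule st(2))
qed

text \<open>\<open>h_of\<close> sends \<open>\<eta> a\<close> to right translation by
  \<open>a\<close>, which moves the class of the identity to the class of \<open>a\<close>.
  Comparing cosets thus amounts to comparing classes.\<close>

lemma kappa_below_eta:
  assumes C: "C \<in> PV V G" and c: "a \<in> carrier G" "b \<in> carrier G"
  shows "coset_below F (kappa G F \<eta> C) (\<eta> a) (\<eta> b) \<longleftrightarrow> (a, b) \<in> preorder_of G C"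
  using kappa_prime(2)[OF C eta.hom_closed[OF c(1)] eta.hom_closed[OF c(2)]]
    po_group_precone.Omega_le_cls[OF precone_PV[OF C] c]
  by (simp only: h_of_eta_base[OF C] c)

lemma Spec_prime: "P \<in> Spec F \<Longrightarrow> prime_in_l_group F P"
  by unfold_locales (simp add: Spec_def)

lemma prime_rel_iff:
  assumes P: "P \<in> Spec F" and c: "a \<in> carrier G" "b \<in> carrier G"
  shows "(a, b) \<in> prime_rel G F \<eta> P \<longleftrightarrow> coset_below F P (\<eta> a) (\<eta> b)"
proof -
  interpret P: prime_in_l_group F P by (rule Spec_prime[OF P])
  show ?thesis using P.coset_le_iff_below[of "\<eta> a" "\<eta> b"] c by (simp add: prime_rel_def)
qed

lemma mem_ppi_iff:
  "P \<in> Spec F \<Longrightarrow> a \<in> ppi G F \<eta> P \<longleftrightarrow> a \<in> carrier G \<and> coset_below F P \<one>\<^bsub>F\<^esub> (\<eta> a)"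
  using prime_rel_iff[of P "\<one>\<^bsub>G\<^esub>" a] by (auto simp: ppi_def cone_of_def)

lemma ppi_kappa:
  assumes C: "C \<in> PV V G"
  shows "ppi G F \<eta> (kappa G F \<eta> C) = C"
proof (rule Set.set_eqI)
  interpret C: po_group_precone G C by (rule precone_PV[OF C])
  fix a
  show "a \<in> ppi G F \<eta> (kappa G F \<eta> C) \<longleftrightarrow> a \<in> C"
    using mem_ppi_iff[OF kappa_prime(1)[OF C], of a] kappa_below_eta[OF C G.one_closed, of a]
      C.mem_C_iff[of a] C.pre_closed[of "\<one>\<^bsub>G\<^esub>" a] by auto
qed

text \<open>Reads strict positivity of a generator off the pre-cone; every reduction to generators
  ends here.\<close>

lemma below_one_eta_iff:
  assumes P: "P \<in> Spec F" and a: "a \<in> carrier G"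
  shows "\<not> coset_below F P (\<eta> a) \<one>\<^bsub>F\<^esub> \<longleftrightarrow> inv\<^bsub>G\<^esub> a \<notin> ppi G F \<eta> P"
proof -
  interpret P: prime_in_l_group F P by (rule Spec_prime[OF P])
  show ?thesis using mem_ppi_iff[OF P] a P.below_iff_inv_above[of "\<eta> a"] by simp
qed

end

section \<open>The action of the free object on the cosets of one prime\<close>

locale free_l_group_prime = free_l_group_over +
  fixes P
  assumes P: "P \<in> Spec F"
begin

sublocale P: prime_in_l_group F P
  by (rule Spec_prime[OF P])

abbreviation "Q \<equiv> ppi G F \<eta> P"

lemma right_preorder_prime_rel: "right_preorder G (prime_rel G F \<eta> P)"
proof -
  note iff = prime_rel_iff[OF P]
  show ?thesis
    unfolding right_preorder_def
  proof (intro conjI)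
    show sub: "prime_rel G F \<eta> P \<subseteq> carrier G \<times> carrier G" by (auto simp: prime_rel_def)
    show "refl_on (carrier G) (prime_rel G F \<eta> P)"
      by (rule refl_onI) (simp add: iff P.below_refl)
    show "trans (prime_rel G F \<eta> P)"
    proof (rule transI)
      fix a b c assume ab: "(a, b) \<in> prime_rel G F \<eta> P" and bc: "(b, c) \<in> prime_rel G F \<eta> P"
      have c: "a \<in> carrier G" "b \<in> carrier G" "c \<in> carrier G" using ab bc sub by blast+
      show "(a, c) \<in> prime_rel G F \<eta> P"
        using ab bc P.below_trans[of "\<eta> a" "\<eta> b" "\<eta> c"] by (simp add: iff c)
    qed
    show "total_on (carrier G) (prime_rel G F \<eta> P)"
      by (rule total_onI) (simp add: iff P.below_total)
    show "prime_rel G F \<eta> P \<noteq> carrier G \<times> carrier G"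
    proof
      \<comment> \<open>If all \<open>\<eta> a\<close> were equivalent to the identity, they would
        lie in \<open>P\<close>; closed under joins and meets, \<open>P\<close> would then be all of
        \<open>F\<close>.\<close>
      assume "prime_rel G F \<eta> P = carrier G \<times> carrier G"
      then have all: "P.below (\<eta> a) (\<eta> b)" if "a \<in> carrier G" "b \<in> carrier G" for a b
        using iff[of a b] that by blast
      have "x \<in> P" if "x \<in> carrier F" for x
        using that
      proof (induction rule: F_induct)
        case (eta a)
        then show ?case
          using P.mem_iff_below[of "\<eta> a"] all[of a "\<one>\<^bsub>G\<^esub>"] all[of "\<one>\<^bsub>G\<^esub>" a] by simp
      qed (rule P.ojoin_mem P.omeet_mem; assumption)+
      then show False using P.proper P.K.subset by blast
    qed
    show "\<forall>a\<in>carrier G. \<forall>b\<in>carrier G. a \<preceq>\<^bsub>G\<^esub> b \<longrightarrow> (a, b) \<in> prime_rel G F \<eta> P"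
      by (simp add: iff P.below_if_le eta_le)
    show "\<forall>t\<in>carrier G. \<forall>(a, b)\<in>prime_rel G F \<eta> P.
        (a \<otimes>\<^bsub>G\<^esub> t, b \<otimes>\<^bsub>G\<^esub> t) \<in> prime_rel G F \<eta> P"
    proof clarify
      fix t a b assume t: "t \<in> carrier G" and ab: "(a, b) \<in> prime_rel G F \<eta> P"
      have c: "a \<in> carrier G" "b \<in> carrier G" using ab sub by blast+
      show "(a \<otimes>\<^bsub>G\<^esub> t, b \<otimes>\<^bsub>G\<^esub> t) \<in> prime_rel G F \<eta> P"
        using ab t c by (simp add: iff P.below_mult_right_iff)
    qed
  qed
qed

sublocale Q: po_group_precone G Q
  by unfold_locales (use right_preorder_prime_rel in \<open>auto simp: precone_def ppi_def\<close>)

lemma pre_iff: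
  "\<lbrakk>a \<in> carrier G; b \<in> carrier G\<rbrakk> \<Longrightarrow> (a, b) \<in> preorder_of G Q \<longleftrightarrow> P.below (\<eta> a) (\<eta> b)"
  using G.preorder_of_cone_of[OF right_preorder_prime_rel] prime_rel_iff[OF P]
  by (simp add: ppi_def)

text \<open>Stands for equality of the right cosets of \<open>x\<close> and
  \<open>y\<close>.\<close>

definition same (infix \<open>\<approx>\<close> 50) where "x \<approx> y \<longleftrightarrow> P.below x y \<and> P.below y x"

lemma same_sym: "x \<approx> y \<Longrightarrow> y \<approx> x"
  by (simp add: same_def)

lemma same_trans:
  "\<lbrakk>x \<approx> y; y \<approx> z; x \<in> carrier F; y \<in> carrier F; z \<in> carrier F\<rbrakk> \<Longrightarrow> x \<approx> z"
  unfolding same_def using P.below_trans by blast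

lemma same_mult:
  "\<lbrakk>x \<approx> y; x \<in> carrier F; y \<in> carrier F; s \<in> carrier F\<rbrakk> \<Longrightarrow> x \<otimes>\<^bsub>F\<^esub> s \<approx> y \<otimes>\<^bsub>F\<^esub> s"
  by (simp add: same_def P.below_mult_right)

lemma cls_eq_iff_same:
  "\<lbrakk>a \<in> carrier G; b \<in> carrier G\<rbrakk> \<Longrightarrow> Q.cls a = Q.cls b \<longleftrightarrow> \<eta> a \<approx> \<eta> b"
  by (simp only: Q.cls_eq_iff pre_iff same_def)

lemma ojoin_same:
  assumes "x \<in> carrier F" "y \<in> carrier F"
  shows "P.below x y \<Longrightarrow> ojoin F x y \<approx> y" and "P.below y x \<Longrightarrow> ojoin F x y \<approx> x"
  using assms P.below_refl[of x] P.below_refl[of y]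
    P.below_if_le[OF F.ojoin_left[OF assms]] P.below_if_le[OF F.ojoin_right[OF assms]]
  by (simp_all add: same_def P.ojoin_below_iff)

lemma omeet_same:
  assumes "x \<in> carrier F" "y \<in> carrier F"
  shows "P.below x y \<Longrightarrow> omeet F x y \<approx> x" and "P.below y x \<Longrightarrow> omeet F x y \<approx> y"
  using assms P.below_refl[of x] P.below_refl[of y]
    P.below_if_le[OF F.omeet_left[OF assms]] P.below_if_le[OF F.omeet_right[OF assms]]
  by (simp_all add: same_def P.below_omeet_iff)

text \<open>Every coset of \<open>P\<close> meets the image of \<open>\<eta>\<close>, because the cosets form a chain and \<open>F\<close> is
  generated by that image as a lattice. Hence \<open>F/P\<close> is the chain \<open>\<Omega>\<^sub>Q\<close>.\<close>

lemma ex_same_eta: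
  assumes "x \<in> carrier F"
  shows "\<exists>b\<in>carrier G. \<eta> b \<approx> x"
  using assms
proof (induction rule: F_induct)
  case (eta a)
  then show ?case using P.below_refl by (intro bexI[of _ a]) (simp_all add: same_def)
next
  case (join x y)
  then have "ojoin F x y \<approx> x \<or> ojoin F x y \<approx> y" using P.below_total[of x y] ojoin_same by blast
  then show ?case using join same_sym same_trans by (metis F.ojoin_closed eta.hom_closed)
next
  case (meet x y)
  then have "omeet F x y \<approx> x \<or> omeet F x y \<approx> y" using P.below_total[of x y] omeet_same by blast
  then show ?case using meet same_sym same_trans by (metis F.omeet_closed eta.hom_closed)
qed

text \<open>Right multiplication of cosets by \<open>x\<close>, transported to classes in
  \<open>G\<close>: the value collects every \<open>b\<close> whose image lies in the translated
  coset. No representative is chosen, so independence of choices is deferred to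
  \<open>act_cls\<close>.\<close>

definition act :: "'b \<Rightarrow> 'a set \<Rightarrow> 'a set" where
  "act x = (\<lambda>X\<in>Omega G Q. {b \<in> carrier G. \<exists>a\<in>X. \<eta> b \<approx> \<eta> a \<otimes>\<^bsub>F\<^esub> x})"

lemma act_cls:
  assumes x: "x \<in> carrier F" and c: "a \<in> carrier G" "b \<in> carrier G" and b: "\<eta> b \<approx> \<eta> a \<otimes>\<^bsub>F\<^esub> x"
  shows "act x (Q.cls a) = Q.cls b"
proof -
  have "(\<exists>a'\<in>Q.cls a. \<eta> b' \<approx> \<eta> a' \<otimes>\<^bsub>F\<^esub> x) \<longleftrightarrow> b' \<in> Q.cls b" if b': "b' \<in> carrier G" for b'
  proof
    assume "b' \<in> Q.cls b"
    then have "\<eta> b' \<approx> \<eta> b" using Q.mem_cls_iff pre_iff c b' by (simp add: same_def)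
    then have "\<eta> b' \<approx> \<eta> a \<otimes>\<^bsub>F\<^esub> x" using b same_trans x c b' by (meson F.m_closed eta.hom_closed)
    moreover have "a \<in> Q.cls a" using Q.mem_cls_iff Q.pre_refl c by blast
    ultimately show "\<exists>a'\<in>Q.cls a. \<eta> b' \<approx> \<eta> a' \<otimes>\<^bsub>F\<^esub> x" by blast
  next
    assume "\<exists>a'\<in>Q.cls a. \<eta> b' \<approx> \<eta> a' \<otimes>\<^bsub>F\<^esub> x"
    then obtain a' where a': "a' \<in> Q.cls a" "\<eta> b' \<approx> \<eta> a' \<otimes>\<^bsub>F\<^esub> x" by blast
    have a'G: "a' \<in> carrier G" using a'(1) Q.mem_cls_iff Q.pre_closed by blast
    have "\<eta> a' \<approx> \<eta> a" using a'(1) Q.mem_cls_iff pre_iff c a'G by (simp add: same_def)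
    then have "\<eta> a' \<otimes>\<^bsub>F\<^esub> x \<approx> \<eta> a \<otimes>\<^bsub>F\<^esub> x" using same_mult x c a'G by simp
    then have "\<eta> b' \<approx> \<eta> b"
      using a'(2) b same_trans same_sym x c b' a'G by (meson F.m_closed eta.hom_closed)
    then show "b' \<in> Q.cls b" using Q.mem_cls_iff pre_iff c b' by (simp add: same_def)
  qed
  moreover have "Q.cls b \<subseteq> carrier G" using Q.mem_cls_iff Q.pre_closed by blast
  ultimately have "{b' \<in> carrier G. \<exists>a'\<in>Q.cls a. \<eta> b' \<approx> \<eta> a' \<otimes>\<^bsub>F\<^esub> x} = Q.cls b" by blast
  then show ?thesis using Q.cls_Omega[OF c(1)] unfolding act_def by (simp only: restrict_apply')
qed

lemma act_ex:
  assumes "x \<in> carrier F" "X \<in> Omega G Q"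
  obtains a b where "a \<in> carrier G" "b \<in> carrier G" "X = Q.cls a" "\<eta> b \<approx> \<eta> a \<otimes>\<^bsub>F\<^esub> x"
    "act x X = Q.cls b"
proof -
  obtain a where a: "a \<in> carrier G" "X = Q.cls a" using assms(2) unfolding Q.Omega_iff by blast
  obtain b where b: "b \<in> carrier G" "\<eta> b \<approx> \<eta> a \<otimes>\<^bsub>F\<^esub> x"
    using ex_same_eta[of "\<eta> a \<otimes>\<^bsub>F\<^esub> x"] a assms(1) by auto
  show thesis using that[OF a(1) b(1) a(2) b(2)] act_cls[OF assms(1) a(1) b] a(2) by blast
qed

lemma below_cong:
  assumes "x \<approx> x'" "y \<approx> y'" "x \<in> carrier F" "x' \<in> carrier F" "y \<in> carrier F" "y' \<in> carrier F"
  shows "P.below x y \<longleftrightarrow> P.below x' y'"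
  using assms P.below_trans unfolding same_def by metis

lemma act_Aut:
  assumes x: "x \<in> carrier F"
  shows "act x \<in> carrier Q.Om.Aut"
proof (rule Q.Om.AutI)
  show "act x \<in> extensional (Omega G Q)" by (simp add: act_def)
  show "act x ` Omega G Q = Omega G Q"
  proof
    show "act x ` Omega G Q \<subseteq> Omega G Q"
    proof (rule image_subsetI)
      fix X assume "X \<in> Omega G Q"
      then obtain a b where "b \<in> carrier G" "act x X = Q.cls b" using act_ex[OF x] by metis
      then show "act x X \<in> Omega G Q" using Q.cls_Omega by simp
    qed
    show "Omega G Q \<subseteq> act x ` Omega G Q"
    proof
      fix Y assume "Y \<in> Omega G Q"
      then obtain b where b: "b \<in> carrier G" "Y = Q.cls b" unfolding Q.Omega_iff by blast
      \<comment> \<open>The preimage is a representative in \<open>G\<close> of the coset translated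
        back by the inverse of \<open>x\<close>.\<close>
      obtain a where a: "a \<in> carrier G" "\<eta> a \<approx> \<eta> b \<otimes>\<^bsub>F\<^esub> inv\<^bsub>F\<^esub> x"
        using ex_same_eta[of "\<eta> b \<otimes>\<^bsub>F\<^esub> inv\<^bsub>F\<^esub> x"] b x by auto
      have "\<eta> a \<otimes>\<^bsub>F\<^esub> x \<approx> \<eta> b \<otimes>\<^bsub>F\<^esub> inv\<^bsub>F\<^esub> x \<otimes>\<^bsub>F\<^esub> x" using a b x by (intro same_mult) simp_all
      then have "\<eta> b \<approx> \<eta> a \<otimes>\<^bsub>F\<^esub> x" using a b x same_sym by (simp add: F.m_assoc)
      then have "act x (Q.cls a) = Y" using act_cls[OF x a(1) b(1)] b(2) by simp
      then show "Y \<in> act x ` Omega G Q" using Q.cls_Omega[OF a(1)] by blast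
    qed
  qed
  show "Omega_le G Q (act x X) (act x Y) \<longleftrightarrow> Omega_le G Q X Y"
    if XY: "X \<in> Omega G Q" "Y \<in> Omega G Q" for X Y
  proof -
    obtain a b where ab: "a \<in> carrier G" "b \<in> carrier G" "X = Q.cls a" "\<eta> b \<approx> \<eta> a \<otimes>\<^bsub>F\<^esub> x"
      "act x X = Q.cls b" using act_ex[OF x XY(1)] .
    obtain c d where cd: "c \<in> carrier G" "d \<in> carrier G" "Y = Q.cls c" "\<eta> d \<approx> \<eta> c \<otimes>\<^bsub>F\<^esub> x"
      "act x Y = Q.cls d" using act_ex[OF x XY(2)] .
    have "P.below (\<eta> b) (\<eta> d) \<longleftrightarrow> P.below (\<eta> a \<otimes>\<^bsub>F\<^esub> x) (\<eta> c \<otimes>\<^bsub>F\<^esub> x)"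
      using ab cd x by (intro below_cong) simp_all
    then show ?thesis
      unfolding ab(5) cd(5) unfolding ab(3) cd(3)
      using ab(1,2) cd(1,2) x by (simp add: Q.Omega_le_cls pre_iff P.below_mult_right_iff)
  qed
qed

lemma act_eqI:
  assumes x: "x \<in> carrier F" and f: "f \<in> carrier Q.Om.Aut"
    and eq: "\<And>a b. \<lbrakk>a \<in> carrier G; b \<in> carrier G; \<eta> b \<approx> \<eta> a \<otimes>\<^bsub>F\<^esub> x\<rbrakk> \<Longrightarrow> f (Q.cls a) = Q.cls b"
  shows "act x = f"
proof (rule Q.Om.Aut_eqI[OF act_Aut[OF x] f])
  fix X assume X: "X \<in> Omega G Q"
  obtain a b where "a \<in> carrier G" "b \<in> carrier G" "X = Q.cls a" "\<eta> b \<approx> \<eta> a \<otimes>\<^bsub>F\<^esub> x"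
    "act x X = Q.cls b" using act_ex[OF x X] .
  then show "act x X = f X" using eq by simp
qed

lemma act_eta:
  assumes c: "c \<in> carrier G"
  shows "act (\<eta> c) = R_map G Q c"
proof (rule act_eqI)
  show "R_map G Q c \<in> carrier Q.Om.Aut" using Q.R_map_Aut[OF c] by (simp add: Aut_Omega_def)
  fix a b assume ab: "a \<in> carrier G" "b \<in> carrier G" "\<eta> b \<approx> \<eta> a \<otimes>\<^bsub>F\<^esub> \<eta> c"
  then have "Q.cls (a \<otimes>\<^bsub>G\<^esub> c) = Q.cls b"
    using c same_sym by (subst cls_eq_iff_same) simp_all
  then show "R_map G Q c (Q.cls a) = Q.cls b" using Q.R_map_cls[OF c ab(1)] by simp
qed (use c in simp)

lemma act_mult:
  assumes x: "x \<in> carrier F" and y: "y \<in> carrier F"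
  shows "act (x \<otimes>\<^bsub>F\<^esub> y) = act x \<otimes>\<^bsub>Q.Om.Aut\<^esub> act y"
proof (rule act_eqI)
  interpret A: group Q.Om.Aut by (rule Q.Om.group_Aut)
  show "act x \<otimes>\<^bsub>Q.Om.Aut\<^esub> act y \<in> carrier Q.Om.Aut" by (rule A.m_closed[OF act_Aut[OF x] act_Aut[OF y]])
  fix a b assume ab: "a \<in> carrier G" "b \<in> carrier G" "\<eta> b \<approx> \<eta> a \<otimes>\<^bsub>F\<^esub> (x \<otimes>\<^bsub>F\<^esub> y)"
  \<comment> \<open>\<open>c\<close> represents the intermediate coset, reached after acting by
    \<open>x\<close> alone.\<close>
  obtain c where c: "c \<in> carrier G" "\<eta> c \<approx> \<eta> a \<otimes>\<^bsub>F\<^esub> x"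
    using ex_same_eta[of "\<eta> a \<otimes>\<^bsub>F\<^esub> x"] ab x by auto
  have "\<eta> a \<otimes>\<^bsub>F\<^esub> x \<otimes>\<^bsub>F\<^esub> y \<approx> \<eta> c \<otimes>\<^bsub>F\<^esub> y"
    using ab c x y by (intro same_mult same_sym[OF c(2)]) simp_all
  then have "\<eta> b \<approx> \<eta> c \<otimes>\<^bsub>F\<^esub> y"
    using same_trans[OF ab(3)] ab c x y by (simp add: F.m_assoc)
  then have "act y (Q.cls c) = Q.cls b" using act_cls y c(1) ab(2) by blast
  then show "(act x \<otimes>\<^bsub>Q.Om.Aut\<^esub> act y) (Q.cls a) = Q.cls b"
    using act_cls[OF x ab(1) c] Q.cls_Omega[OF ab(1)] by (simp add: compose_def)
qed (use x y in simp)

text \<open>Left multiplication by \<open>\<eta> a\<close> distributes over the join, and in a chain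
  the coset of a join is the larger of the two cosets. This is the value of the pointwise maximum;
  meets are dual.\<close>

lemma act_lattice:
  assumes x: "x \<in> carrier F" and y: "y \<in> carrier F"
  shows "act (ojoin F x y) = ojoin Q.Om.Aut (act x) (act y)"
    and "act (omeet F x y) = omeet Q.Om.Aut (act x) (act y)"
proof -
  note Ax = act_Aut[OF x] and Ay = act_Aut[OF y]
  have le: "Omega_le G Q (act x (Q.cls a)) (act y (Q.cls a)) \<longleftrightarrow>
      P.below (\<eta> a \<otimes>\<^bsub>F\<^esub> x) (\<eta> a \<otimes>\<^bsub>F\<^esub> y)" if a: "a \<in> carrier G" for a
  proof -
    obtain b where b: "b \<in> carrier G" "\<eta> b \<approx> \<eta> a \<otimes>\<^bsub>F\<^esub> x"
      using ex_same_eta[of "\<eta> a \<otimes>\<^bsub>F\<^esub> x"] a x by auto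
    obtain c where c: "c \<in> carrier G" "\<eta> c \<approx> \<eta> a \<otimes>\<^bsub>F\<^esub> y"
      using ex_same_eta[of "\<eta> a \<otimes>\<^bsub>F\<^esub> y"] a y by auto
    have "P.below (\<eta> b) (\<eta> c) \<longleftrightarrow> P.below (\<eta> a \<otimes>\<^bsub>F\<^esub> x) (\<eta> a \<otimes>\<^bsub>F\<^esub> y)"
      using a b c x y by (intro below_cong) simp_all
    then show ?thesis
      unfolding act_cls[OF x a b] act_cls[OF y a c] Q.Omega_le_cls[OF b(1) c(1)] pre_iff[OF b(1) c(1)] .
  qed
  show "act (ojoin F x y) = ojoin Q.Om.Aut (act x) (act y)"
    unfolding Q.Om.ojoin_Aut[OF Ax Ay]
  proof (rule act_eqI[OF _ Q.Om.cmax_Aut(1)[OF Ax Ay]])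
    fix a b assume ab: "a \<in> carrier G" "b \<in> carrier G" "\<eta> b \<approx> \<eta> a \<otimes>\<^bsub>F\<^esub> ojoin F x y"
    let ?ax = "\<eta> a \<otimes>\<^bsub>F\<^esub> x" and ?ay = "\<eta> a \<otimes>\<^bsub>F\<^esub> y"
    have c: "?ax \<in> carrier F" "?ay \<in> carrier F" "ojoin F ?ax ?ay \<in> carrier F" "\<eta> b \<in> carrier F"
      using ab x y by simp_all
    have b: "\<eta> b \<approx> ojoin F ?ax ?ay" using ab x y F.mult_ojoin_left[of "\<eta> a" x y] by simp
    show "Q.Om.cmax (act x) (act y) (Q.cls a) = Q.cls b"
    proof (cases "P.below ?ax ?ay")
      case True
      then have "\<eta> b \<approx> ?ay" using same_trans[OF b ojoin_same(1)] c by blast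
      then show ?thesis
        using True le[OF ab(1)] act_cls[OF y ab(1,2)]
        by (simp add: Q.Om.cmax_apply[OF Q.cls_Omega[OF ab(1)]])
    next
      case False
      then have "P.below ?ay ?ax" using P.below_total c by blast
      then have "\<eta> b \<approx> ?ax" using same_trans[OF b ojoin_same(2)] c by blast
      then show ?thesis
        using False le[OF ab(1)] act_cls[OF x ab(1,2)]
        by (simp add: Q.Om.cmax_apply[OF Q.cls_Omega[OF ab(1)]])
    qed
  qed (use x y in simp)
  show "act (omeet F x y) = omeet Q.Om.Aut (act x) (act y)"
    unfolding Q.Om.omeet_Aut[OF Ax Ay]
  proof (rule act_eqI[OF _ Q.Om.cmax_Aut(2)[OF Ax Ay]])
    fix a b assume ab: "a \<in> carrier G" "b \<in> carrier G" "\<eta> b \<approx> \<eta> a \<otimes>\<^bsub>F\<^esub> omeet F x y"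
    let ?ax = "\<eta> a \<otimes>\<^bsub>F\<^esub> x" and ?ay = "\<eta> a \<otimes>\<^bsub>F\<^esub> y"
    have c: "?ax \<in> carrier F" "?ay \<in> carrier F" "omeet F ?ax ?ay \<in> carrier F" "\<eta> b \<in> carrier F"
      using ab x y by simp_all
    have b: "\<eta> b \<approx> omeet F ?ax ?ay" using ab x y F.mult_omeet_left[of "\<eta> a" x y] by simp
    show "Q.Om.cmin (act x) (act y) (Q.cls a) = Q.cls b"
    proof (cases "P.below ?ax ?ay")
      case True
      then have "\<eta> b \<approx> ?ax" using same_trans[OF b omeet_same(1)] c by blast
      then show ?thesis
        using True le[OF ab(1)] act_cls[OF x ab(1,2)]
        by (simp add: Q.Om.cmin_apply[OF Q.cls_Omega[OF ab(1)]])
    next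
      case False
      then have "P.below ?ay ?ax" using P.below_total c by blast
      then have "\<eta> b \<approx> ?ay" using same_trans[OF b omeet_same(2)] c by blast
      then show ?thesis
        using False le[OF ab(1)] act_cls[OF y ab(1,2)]
        by (simp add: Q.Om.cmin_apply[OF Q.cls_Omega[OF ab(1)]])
    qed
  qed (use x y in simp)
qed

lemma act_l_hom: "l_hom F Q.AutC act"
  unfolding l_hom_def Aut_Omega_def
  using act_Aut act_mult act_lattice by (auto simp: hom_def simp del: Q.Om.Aut_simps)

text \<open>On generators \<open>act\<close> is \<open>R_map\<close>, so its values lie in the
  generated l-subgroup. Conversely the image is itself an l-subgroup containing all
  \<open>R_map G Q a\<close>, and the generated one is the least such.\<close>

lemma act_image: "act ` carrier F = carrier (H_of G Q)"
proof
  let ?H = "carrier (H_of G Q)"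
  have H: "l_subgroup ?H Q.AutC" by (rule Q.l_subgroup_H)
  have "act x \<in> ?H" if "x \<in> carrier F" for x
    using that
  proof (induction rule: F_induct)
    case (eta a)
    then show ?case using act_eta Q.R_map_H by auto
  next
    case (join x y)
    then show ?case using H act_l_hom unfolding l_subgroup_def l_hom_def by metis
  next
    case (meet x y)
    then show ?case using H act_l_hom unfolding l_subgroup_def l_hom_def by metis
  qed
  then show "act ` carrier F \<subseteq> ?H" by blast
  have "group_hom F Q.AutC act"
    using act_l_hom l_group.axioms(1)[OF Q.l_group_Aut_Omega]
    by (intro group_hom.intro group_hom_axioms.intro)
      (auto simp: l_hom_def po_group_def)
  then have "subgroup (act ` carrier F) Q.AutC"
    by (rule group_hom.img_is_subgroup)
  moreover have "ojoin Q.AutC u v \<in> act ` carrier F \<and> omeet Q.AutC u v \<in> act ` carrier F"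
    if uv: "u \<in> act ` carrier F" "v \<in> act ` carrier F" for u v
  proof -
    obtain x y where xy: "x \<in> carrier F" "y \<in> carrier F" "u = act x" "v = act y" using uv by blast
    have "ojoin Q.AutC u v = act (ojoin F x y)" "omeet Q.AutC u v = act (omeet F x y)"
      using act_l_hom xy by (simp_all add: l_hom_def)
    then show ?thesis using xy F.ojoin_closed F.omeet_closed by blast
  qed
  ultimately have "l_subgroup (act ` carrier F) Q.AutC" by (simp add: l_subgroup_def)
  moreover have "R_map G Q ` carrier G \<subseteq> act ` carrier F"
    using act_eta by (metis eta.hom_closed image_eqI image_subsetI)
  ultimately show "?H \<subseteq> act ` carrier F"
    using l_group.l_generated_minimal[OF Q.l_group_Aut_Omega] by (simp add: H_of_def)
qed

lemma act_l_hom_H: "l_hom F (H_of G Q) act"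
  by (rule iffD2[OF Q.l_hom_H_iff act_l_hom]) (simp add: act_image)

lemma ppi_PV: "Q \<in> PV V G"
  using Q.C in_variety_image[OF F_in_V Q.l_group_H act_l_hom_H] act_image
  by (simp add: PV_def)

lemma h_of_ppi: "x \<in> carrier F \<Longrightarrow> h_of G F \<eta> Q x = act x"
proof -
  \<comment> \<open>Uniqueness of \<open>h_of\<close> is stated for extensional functions, so
    \<open>act\<close> is first cut down to the carrier.\<close>
  have "l_hom F (H_of G Q) (restrict act (carrier F))"
    using act_l_hom_H by (auto simp: l_hom_def hom_def)
  then have "h_of G F \<eta> Q = restrict act (carrier F)"
    by (intro h_of_eqI ppi_PV) (simp_all add: act_eta)
  then show "x \<in> carrier F \<Longrightarrow> h_of G F \<eta> Q x = act x" by simp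
qed

lemma kappa_ppi: "kappa G F \<eta> Q = P"
proof -
  have "h_of G F \<eta> Q x (base Q) = base Q \<longleftrightarrow> x \<in> P" if x: "x \<in> carrier F" for x
  proof -
    \<comment> \<open>\<open>b\<close> represents the coset of \<open>x\<close>, to which
      \<open>x\<close> moves \<open>P\<close>; the base class is fixed iff this coset is
      \<open>P\<close> itself.\<close>
    obtain b where b: "b \<in> carrier G" "\<eta> b \<approx> x" using ex_same_eta[OF x] by blast
    have "act x (base Q) = Q.cls b" using act_cls[OF x G.one_closed b(1)] b(2) x by simp
    then have "h_of G F \<eta> Q x (base Q) = base Q \<longleftrightarrow> \<eta> b \<approx> \<one>\<^bsub>F\<^esub>"
      using h_of_ppi[OF x] cls_eq_iff_same[OF b(1) G.one_closed] by simp
    also have "\<dots> \<longleftrightarrow> x \<approx> \<one>\<^bsub>F\<^esub>"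
      using b x same_trans same_sym by (meson F.one_closed eta.hom_closed)
    also have "\<dots> \<longleftrightarrow> x \<in> P" using P.mem_iff_below[OF x] by (simp add: same_def)
    finally show ?thesis .
  qed
  then show ?thesis unfolding kappa_eq[OF ppi_PV] using P.K.subset by blast
qed

end

section \<open>Order and topology\<close>

context free_l_group_over
begin

lemma prime_over: "P \<in> Spec F \<Longrightarrow> free_l_group_prime G F \<eta> V P"
  by unfold_locales

lemma kappa_ppi: "P \<in> Spec F \<Longrightarrow> kappa G F \<eta> (ppi G F \<eta> P) = P"
  by (rule free_l_group_prime.kappa_ppi[OF prime_over])

lemma ppi_PV: "P \<in> Spec F \<Longrightarrow> ppi G F \<eta> P \<in> PV V G"
  by (rule free_l_group_prime.ppi_PV[OF prime_over])

text \<open>Being strictly positive modulo a prime is decided on generators: for a join (meet) it holds iff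
  it holds for one (both) of the arguments. So inclusions of primes, invariance under
  conjugation and openness in \<open>continuous_kappa\<close> reduce to elements \<open>\<eta> a\<close>.\<close>

lemma positive_transfer:
  assumes P: "P \<in> Spec F" and P': "P' \<in> Spec F" and x: "x \<in> carrier F"
    and \<alpha>: "\<And>x. x \<in> carrier F \<Longrightarrow> \<alpha> x \<in> carrier F"
      "\<And>x y. \<lbrakk>x \<in> carrier F; y \<in> carrier F\<rbrakk> \<Longrightarrow> \<alpha> (ojoin F x y) = ojoin F (\<alpha> x) (\<alpha> y)"
      "\<And>x y. \<lbrakk>x \<in> carrier F; y \<in> carrier F\<rbrakk> \<Longrightarrow> \<alpha> (omeet F x y) = omeet F (\<alpha> x) (\<alpha> y)"
    and eta: "\<And>a. \<lbrakk>a \<in> carrier G; \<not> coset_below F P (\<eta> a) \<one>\<^bsub>F\<^esub>\<rbrakk> \<Longrightarrow>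
      \<not> coset_below F P' (\<alpha> (\<eta> a)) \<one>\<^bsub>F\<^esub>"
    and pos: "\<not> coset_below F P x \<one>\<^bsub>F\<^esub>"
  shows "\<not> coset_below F P' (\<alpha> x) \<one>\<^bsub>F\<^esub>"
proof -
  interpret P: prime_in_l_group F P by (rule Spec_prime[OF P])
  interpret P': prime_in_l_group F P' by (rule Spec_prime[OF P'])
  have "\<not> P.below x \<one>\<^bsub>F\<^esub> \<longrightarrow> \<not> P'.below (\<alpha> x) \<one>\<^bsub>F\<^esub>"
    using x
  proof (induction rule: F_induct)
    case (eta a)
    then show ?case using assms(7) by blast
  next
    case (join x y)
    have "\<alpha> (ojoin F x y) = ojoin F (\<alpha> x) (\<alpha> y)" using \<alpha>(2) join(1,2) .
    then show ?case
      using join(3,4) P.positive_ojoin_iff[OF join(1,2)]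
        P'.positive_ojoin_iff[OF \<alpha>(1)[OF join(1)] \<alpha>(1)[OF join(2)]] by metis
  next
    case (meet x y)
    have "\<alpha> (omeet F x y) = omeet F (\<alpha> x) (\<alpha> y)" using \<alpha>(3) meet(1,2) .
    then show ?case
      using meet(3,4) P.positive_omeet_iff[OF meet(1,2)]
        P'.positive_omeet_iff[OF \<alpha>(1)[OF meet(1)] \<alpha>(1)[OF meet(2)]] by metis
  qed
  then show ?thesis using pos by blast
qed

text \<open>Strict positivity is contravariant in the cone: \<open>inv a\<close> outside
  \<open>D\<close> is also outside \<open>C\<close>. The transfer, with \<open>\<alpha>\<close> the
  identity, runs from \<open>D\<close> to \<open>C\<close>, and its contrapositive carries being
  below the identity from \<open>C\<close> to \<open>D\<close>, both for an element and for its
  inverse.\<close>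

lemma kappa_mono:
  assumes C: "C \<in> PV V G" and D: "D \<in> PV V G" and CD: "C \<subseteq> D"
  shows "kappa G F \<eta> C \<subseteq> kappa G F \<eta> D"
proof
  note P = kappa_prime(1)[OF C] and P' = kappa_prime(1)[OF D]
  interpret P: prime_in_l_group F "kappa G F \<eta> C" by (rule Spec_prime[OF P])
  interpret P': prime_in_l_group F "kappa G F \<eta> D" by (rule Spec_prime[OF P'])
  have below: "P'.below x \<one>\<^bsub>F\<^esub>" if "P.below x \<one>\<^bsub>F\<^esub>" "x \<in> carrier F" for x
  proof (rule ccontr)
    assume n: "\<not> P'.below x \<one>\<^bsub>F\<^esub>"
    have "\<not> P.below x \<one>\<^bsub>F\<^esub>"
    proof (rule positive_transfer[OF P' P that(2), where \<alpha> = "\<lambda>x. x", OF _ _ _ _ n])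
      fix a assume a: "a \<in> carrier G" "\<not> P'.below (\<eta> a) \<one>\<^bsub>F\<^esub>"
      then show "\<not> P.below (\<eta> a) \<one>\<^bsub>F\<^esub>"
        using below_one_eta_iff[OF P' a(1)] below_one_eta_iff[OF P a(1)] ppi_kappa[OF C]
          ppi_kappa[OF D] CD by blast
    qed simp_all
    then show False using that(1) by blast
  qed
  fix x assume x: "x \<in> kappa G F \<eta> C"
  then have c: "x \<in> carrier F" by (rule P.K.mem_carrier)
  show "x \<in> kappa G F \<eta> D"
    using P.mem_iff_not_positive[OF c] P'.mem_iff_not_positive[OF c]
      below[OF _ c] below[OF _ F.inv_closed[OF c]] x by blast
qed

lemma ppi_mono:
  assumes P: "P \<in> Spec F" and P': "P' \<in> Spec F" and sub: "P \<subseteq> P'"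
  shows "ppi G F \<eta> P \<subseteq> ppi G F \<eta> P'"
  using sub unfolding subset_iff mem_ppi_iff[OF P] mem_ppi_iff[OF P'] coset_below_def by blast

text \<open>Conjugation by \<open>\<eta> t\<close> respects joins and meets, so
  \<open>positive_transfer\<close>, from the prime to itself, needs only generators; there it is
  two-sided invariance of the pre-order.\<close>

lemma kappa_conj:
  assumes C: "C \<in> BV V G" and t: "t \<in> carrier G" and x: "x \<in> kappa G F \<eta> C"
  shows "\<eta> t \<otimes>\<^bsub>F\<^esub> x \<otimes>\<^bsub>F\<^esub> inv\<^bsub>F\<^esub> \<eta> t \<in> kappa G F \<eta> C"
proof -
  have CP: "C \<in> PV V G" using C by (simp add: BV_def)
  interpret C: po_group_precone G C by (rule precone_PV[OF CP])
  note P = kappa_prime(1)[OF CP]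
  interpret P: prime_in_l_group F "kappa G F \<eta> C" by (rule Spec_prime[OF P])
  let ?cj = "\<lambda>s x. \<eta> s \<otimes>\<^bsub>F\<^esub> x \<otimes>\<^bsub>F\<^esub> inv\<^bsub>F\<^esub> \<eta> s"
  have pos: "\<not> P.below (?cj s y) \<one>\<^bsub>F\<^esub>" if s: "s \<in> carrier G" and y: "y \<in> carrier F"
    and n: "\<not> P.below y \<one>\<^bsub>F\<^esub>" for s y
  proof (rule positive_transfer[OF P P y, where \<alpha> = "?cj s", OF _ _ _ _ n])
    fix a assume a: "a \<in> carrier G" "\<not> P.below (\<eta> a) \<one>\<^bsub>F\<^esub>"
    let ?b = "s \<otimes>\<^bsub>G\<^esub> a \<otimes>\<^bsub>G\<^esub> inv\<^bsub>G\<^esub> s"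
    have b: "?b \<in> carrier G" using a s by simp
    have eb: "\<eta> ?b = ?cj s (\<eta> a)" using a s by simp
    have ib: "inv\<^bsub>G\<^esub> ?b = s \<otimes>\<^bsub>G\<^esub> inv\<^bsub>G\<^esub> a \<otimes>\<^bsub>G\<^esub> inv\<^bsub>G\<^esub> s"
      using a s by (simp add: G.inv_mult_group G.m_assoc)
    have "inv\<^bsub>G\<^esub> ?b \<notin> C"
    proof
      assume "inv\<^bsub>G\<^esub> ?b \<in> C"
      then have "\<one>\<^bsub>G\<^esub> \<sqsubseteq>\<^sub>C s \<otimes>\<^bsub>G\<^esub> inv\<^bsub>G\<^esub> a \<otimes>\<^bsub>G\<^esub> inv\<^bsub>G\<^esub> s" unfolding ib C.mem_C_iff .
      moreover have "inv\<^bsub>G\<^esub> s \<in> carrier G" using s by simp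
      ultimately have "inv\<^bsub>G\<^esub> s \<otimes>\<^bsub>G\<^esub> \<one>\<^bsub>G\<^esub> \<sqsubseteq>\<^sub>C
          inv\<^bsub>G\<^esub> s \<otimes>\<^bsub>G\<^esub> (s \<otimes>\<^bsub>G\<^esub> inv\<^bsub>G\<^esub> a \<otimes>\<^bsub>G\<^esub> inv\<^bsub>G\<^esub> s)"
        using C unfolding BV_def by blast
      from C.pre_mult[OF this s] have "\<one>\<^bsub>G\<^esub> \<sqsubseteq>\<^sub>C inv\<^bsub>G\<^esub> a"
        using a s by (simp add: G.m_assoc G.m_assoc[symmetric, of "inv\<^bsub>G\<^esub> s" s])
      then have "inv\<^bsub>G\<^esub> a \<in> C" unfolding C.mem_C_iff .
      then show False using below_one_eta_iff[OF P a(1)] a(2) ppi_kappa[OF CP] by simp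
    qed
    then show "\<not> P.below (?cj s (\<eta> a)) \<one>\<^bsub>F\<^esub>"
      using below_one_eta_iff[OF P b] ppi_kappa[OF CP] eb by simp
  qed (use s in \<open>simp_all add: F.mult_ojoin_left F.mult_ojoin_right F.mult_omeet_left F.mult_omeet_right\<close>)
  have below: "P.below (?cj t y) \<one>\<^bsub>F\<^esub>" if y: "y \<in> carrier F" and "P.below y \<one>\<^bsub>F\<^esub>" for y
  proof (rule ccontr)
    assume n: "\<not> P.below (?cj t y) \<one>\<^bsub>F\<^esub>"
    \<comment> \<open>Conjugating back by the inverse of \<open>t\<close> shows that being below the
      identity, and not only strict positivity, is preserved.\<close>
    have "\<not> P.below (?cj (inv\<^bsub>G\<^esub> t) (?cj t y)) \<one>\<^bsub>F\<^esub>"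
      by (rule pos[OF _ _ n]) (use t y in simp_all)
    moreover have "?cj (inv\<^bsub>G\<^esub> t) (?cj t y) = y"
      using t y by (simp add: F.m_assoc F.m_assoc[symmetric, of "inv\<^bsub>F\<^esub> \<eta> t" "\<eta> t"])
    ultimately show False using that(2) by simp
  qed
  have c: "x \<in> carrier F" using x by (rule P.K.mem_carrier)
  have "inv\<^bsub>F\<^esub> (?cj t x) = ?cj t (inv\<^bsub>F\<^esub> x)"
    using c t by (simp add: F.inv_mult_group F.m_assoc)
  moreover have "?cj t x \<in> carrier F" using c t by simp
  ultimately show ?thesis
    using P.mem_iff_not_positive[OF c] x below[OF c] below[OF F.inv_closed[OF c]]
      P.mem_iff_not_positive[of "?cj t x"] by simp
qed

lemma kappa_normal:
  assumes C: "C \<in> BV V G"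
  shows "kappa G F \<eta> C \<in> Spec_star F"
proof -
  have CP: "C \<in> PV V G" using C by (simp add: BV_def)
  define P where "P = kappa G F \<eta> C"
  have P: "P \<in> Spec F" using kappa_prime(1)[OF CP] by (simp add: P_def)
  interpret free_l_group_prime G F \<eta> V P by (rule prime_over[OF P])
  have "s \<otimes>\<^bsub>F\<^esub> x \<otimes>\<^bsub>F\<^esub> inv\<^bsub>F\<^esub> s \<in> P" if s: "s \<in> carrier F" and x: "x \<in> P" for s x
  proof -
    obtain t where t: "t \<in> carrier G" "same (\<eta> t) s" using ex_same_eta[OF s] by blast
    \<comment> \<open>An arbitrary \<open>s\<close> shares its coset with some
      \<open>\<eta> t\<close>, so it is the product of \<open>p\<close> in \<open>P\<close> and
      \<open>\<eta> t\<close>. Conjugation by \<open>\<eta> t\<close> is covered by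
      \<open>kappa_conj\<close>, and conjugation by \<open>p\<close> stays inside
      \<open>P\<close>.\<close>
    define p where "p = s \<otimes>\<^bsub>F\<^esub> inv\<^bsub>F\<^esub> \<eta> t"
    have "same (s \<otimes>\<^bsub>F\<^esub> inv\<^bsub>F\<^esub> \<eta> t) (\<eta> t \<otimes>\<^bsub>F\<^esub> inv\<^bsub>F\<^esub> \<eta> t)"
      by (rule same_mult[OF same_sym[OF t(2)]]) (use s t(1) in simp_all)
    then have "same p \<one>\<^bsub>F\<^esub>" using t(1) by (simp add: p_def)
    then have p: "p \<in> P" using P.mem_iff_below[of p] s t(1) by (simp add: p_def same_def)
    have "\<eta> t \<otimes>\<^bsub>F\<^esub> x \<otimes>\<^bsub>F\<^esub> inv\<^bsub>F\<^esub> \<eta> t \<in> P" using kappa_conj[OF C t(1)] x by (simp add: P_def)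
    then have "p \<otimes>\<^bsub>F\<^esub> (\<eta> t \<otimes>\<^bsub>F\<^esub> x \<otimes>\<^bsub>F\<^esub> inv\<^bsub>F\<^esub> \<eta> t) \<otimes>\<^bsub>F\<^esub> inv\<^bsub>F\<^esub> p \<in> P" using p by simp
    moreover have "s = p \<otimes>\<^bsub>F\<^esub> \<eta> t" using s t(1) by (simp add: p_def F.m_assoc)
    moreover have "p \<in> carrier F" "x \<in> carrier F" using p x by simp_all
    ultimately show ?thesis using t(1) by (simp add: F.m_assoc F.inv_mult_group)
  qed
  then have "P \<lhd> F" unfolding F.normal_inv_iff using P.subgroup by blast
  then show ?thesis using P by (simp add: Spec_star_def P_def)
qed

lemma ppi_BV:
  assumes P: "P \<in> Spec_star F"
  shows "ppi G F \<eta> P \<in> BV V G"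
proof -
  have P': "P \<in> Spec F" and norm: "P \<lhd> F" using P by (simp_all add: Spec_star_def)
  interpret free_l_group_prime G F \<eta> V P by (rule prime_over[OF P'])
  have "(t \<otimes>\<^bsub>G\<^esub> a, t \<otimes>\<^bsub>G\<^esub> b) \<in> preorder_of G Q"
    if t: "t \<in> carrier G" and ab: "(a, b) \<in> preorder_of G Q" for t a b
  proof -
    have c: "a \<in> carrier G" "b \<in> carrier G" using Q.pre_closed[OF ab] by blast+
    obtain p where p: "p \<in> P" "\<eta> a \<preceq>\<^bsub>F\<^esub> p \<otimes>\<^bsub>F\<^esub> \<eta> b"
      using ab pre_iff[OF c] unfolding coset_below_def by blast
    \<comment> \<open>The comparison needs an element of \<open>P\<close> on the far left; normality
      lets \<open>p\<close> pass through \<open>\<eta> t\<close> as its conjugate.\<close>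
    let ?p = "\<eta> t \<otimes>\<^bsub>F\<^esub> p \<otimes>\<^bsub>F\<^esub> inv\<^bsub>F\<^esub> \<eta> t"
    have pF: "p \<in> carrier F" using p(1) by simp
    have "?p \<in> P" using norm p(1) eta.hom_closed[OF t] unfolding F.normal_inv_iff by blast
    moreover have "\<eta> t \<otimes>\<^bsub>F\<^esub> \<eta> a \<preceq>\<^bsub>F\<^esub> \<eta> t \<otimes>\<^bsub>F\<^esub> (p \<otimes>\<^bsub>F\<^esub> \<eta> b)"
      using p(2) pF c t by (intro F.mult_left_mono) simp_all
    moreover have "\<eta> t \<otimes>\<^bsub>F\<^esub> (p \<otimes>\<^bsub>F\<^esub> \<eta> b) = ?p \<otimes>\<^bsub>F\<^esub> (\<eta> t \<otimes>\<^bsub>F\<^esub> \<eta> b)"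
      using pF c t by (simp add: F.m_assoc F.m_assoc[symmetric, of "inv\<^bsub>F\<^esub> \<eta> t" "\<eta> t"])
    ultimately have "P.below (\<eta> t \<otimes>\<^bsub>F\<^esub> \<eta> a) (\<eta> t \<otimes>\<^bsub>F\<^esub> \<eta> b)"
      unfolding coset_below_def by auto
    then show ?thesis using pre_iff[of "t \<otimes>\<^bsub>G\<^esub> a" "t \<otimes>\<^bsub>G\<^esub> b"] c t by simp
  qed
  then show ?thesis using ppi_PV by (auto simp: BV_def)
qed

section \<open>Continuity of the two maps\<close>

lemma topspace_PV: "topspace (PV_topology V G) = PV V G"
  by (auto simp: PV_topology_def PP_def topology_generated_by_topspace)

lemma topspace_Spec: "topspace (Spec_topology F) = Spec F"
proof
  show "topspace (Spec_topology F) \<subseteq> Spec F"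
    unfolding topspace_def F.openin_Spec_topology by (auto simp: SS_def)
  have "\<not> carrier F \<subseteq> P" if "P \<in> Spec F" for P
    using that by (auto simp: Spec_def prime_subgroup_def convex_l_subgroup_def l_subgroup_def
        dest: subgroup.subset)
  then have "Spec F = SS F (carrier F)" by (auto simp: SS_def)
  then have "openin (Spec_topology F) (Spec F)" unfolding F.openin_Spec_topology by blast
  then show "Spec F \<subseteq> topspace (Spec_topology F)" by (rule openin_subset)
qed

text \<open>For a generator the set is subbasic; joins turn into unions and meets into finite
  intersections, both of which preserve openness.\<close>

lemma open_positive:
  assumes "x \<in> carrier F"
  shows "openin (PV_topology V G) {C \<in> PV V G. \<not> coset_below F (kappa G F \<eta> C) x \<one>\<^bsub>F\<^esub>}"
  using assms
proof (induction rule: F_induct)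
  case (eta a)
  have "\<not> coset_below F (kappa G F \<eta> C) (\<eta> a) \<one>\<^bsub>F\<^esub> \<longleftrightarrow> a \<in> C \<and> inv\<^bsub>G\<^esub> a \<notin> C"
    if C: "C \<in> PV V G" for C
  proof -
    interpret C: po_group_precone G C by (rule precone_PV[OF C])
    \<comment> \<open>Strict positivity says only that \<open>inv a\<close> is not in
      \<open>C\<close>; totality supplies the other half of the subbasic condition.\<close>
    have "a \<in> C \<or> inv\<^bsub>G\<^esub> a \<in> C"
      using C.pre_total[of "\<one>\<^bsub>G\<^esub>" a] C.pre_mult[of a "\<one>\<^bsub>G\<^esub>" "inv\<^bsub>G\<^esub> a"] eta
      by (auto simp: C.mem_C_iff)
    then show ?thesis
      using below_one_eta_iff[OF kappa_prime(1)[OF C] eta] ppi_kappa[OF C] by auto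
  qed
  then have "{C \<in> PV V G. \<not> coset_below F (kappa G F \<eta> C) (\<eta> a) \<one>\<^bsub>F\<^esub>} = PP V G a"
    unfolding PP_def by blast
  then show ?case
    using eta unfolding PV_topology_def by (auto intro!: topology_generated_by_Basis)
next
  case (join x y)
  have "{C \<in> PV V G. \<not> coset_below F (kappa G F \<eta> C) (ojoin F x y) \<one>\<^bsub>F\<^esub>} =
      {C \<in> PV V G. \<not> coset_below F (kappa G F \<eta> C) x \<one>\<^bsub>F\<^esub>} \<union>
      {C \<in> PV V G. \<not> coset_below F (kappa G F \<eta> C) y \<one>\<^bsub>F\<^esub>}"
    using prime_in_l_group.positive_ojoin_iff[OF Spec_prime[OF kappa_prime(1)] join(1,2)] by blast
  then show ?case using openin_Un[OF join(3,4)] by simp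
next
  case (meet x y)
  have "{C \<in> PV V G. \<not> coset_below F (kappa G F \<eta> C) (omeet F x y) \<one>\<^bsub>F\<^esub>} =
      {C \<in> PV V G. \<not> coset_below F (kappa G F \<eta> C) x \<one>\<^bsub>F\<^esub>} \<inter>
      {C \<in> PV V G. \<not> coset_below F (kappa G F \<eta> C) y \<one>\<^bsub>F\<^esub>}"
    using prime_in_l_group.positive_omeet_iff[OF Spec_prime[OF kappa_prime(1)] meet(1,2)] by blast
  then show ?case using openin_Int[OF meet(3,4)] by simp
qed

lemma continuous_kappa:
  "continuous_map (PV_topology V G) (Spec_topology F) (kappa G F \<eta>)"
  unfolding continuous_map_def topspace_PV topspace_Spec
proof (intro conjI allI impI)
  show "kappa G F \<eta> \<in> PV V G \<rightarrow> Spec F" using kappa_prime(1) by blast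
  fix U assume "openin (Spec_topology F) U"
  then obtain A where A: "A \<subseteq> carrier F" "U = SS F A" unfolding F.openin_Spec_topology by blast
  let ?pos = "\<lambda>x. {C \<in> PV V G. \<not> coset_below F (kappa G F \<eta> C) x \<one>\<^bsub>F\<^esub>}"
  \<comment> \<open>Some \<open>x\<close> in \<open>A\<close> must lie outside the prime, that is,
    \<open>x\<close> or its inverse must be strictly positive; the preimage is thus a union of the
    open sets found above.\<close>
  have mem: "kappa G F \<eta> C \<in> U \<longleftrightarrow> (\<exists>x\<in>A. C \<in> ?pos x \<union> ?pos (inv\<^bsub>F\<^esub> x))"
    if C: "C \<in> PV V G" for C
  proof -
    have "kappa G F \<eta> C \<in> U \<longleftrightarrow> (\<exists>x\<in>A. x \<notin> kappa G F \<eta> C)"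
      using kappa_prime(1)[OF C] unfolding A(2) SS_def by blast
    also have "\<dots> \<longleftrightarrow> (\<exists>x\<in>A. C \<in> ?pos x \<union> ?pos (inv\<^bsub>F\<^esub> x))"
    proof (rule bex_cong[OF HOL.refl])
      fix x assume "x \<in> A"
      then have x: "x \<in> carrier F" using A(1) by blast
      show "x \<notin> kappa G F \<eta> C \<longleftrightarrow> C \<in> ?pos x \<union> ?pos (inv\<^bsub>F\<^esub> x)"
        using prime_in_l_group.mem_iff_not_positive[OF Spec_prime[OF kappa_prime(1)[OF C]] x] C
        by simp
    qed
    finally show ?thesis .
  qed
  have "{C \<in> PV V G. kappa G F \<eta> C \<in> U} = (\<Union>x\<in>A. ?pos x \<union> ?pos (inv\<^bsub>F\<^esub> x))"
  proof (rule Set.set_eqI)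
    fix C
    show "C \<in> {C \<in> PV V G. kappa G F \<eta> C \<in> U} \<longleftrightarrow> C \<in> (\<Union>x\<in>A. ?pos x \<union> ?pos (inv\<^bsub>F\<^esub> x))"
      using mem[of C] by (cases "C \<in> PV V G") simp_all
  qed
  moreover have "openin (PV_topology V G) (?pos x \<union> ?pos (inv\<^bsub>F\<^esub> x))" if "x \<in> A" for x
    using that A(1) by (intro openin_Un open_positive) auto
  ultimately show "openin (PV_topology V G) {C \<in> PV V G. kappa G F \<eta> C \<in> U}" by auto
qed

lemma continuous_ppi:
  "continuous_map (Spec_topology F) (PV_topology V G) (ppi G F \<eta>)"
  unfolding PV_topology_def
proof (rule continuous_on_generated_topo)
  show "ppi G F \<eta> ` topspace (Spec_topology F) \<subseteq> \<Union> (insert (PV V G) (PP V G ` carrier G))"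
    using ppi_PV by (auto simp: topspace_Spec)
  fix U assume "U \<in> insert (PV V G) (PP V G ` carrier G)"
  then consider "U = PV V G" | a where "a \<in> carrier G" "U = PP V G a" by blast
  then show "openin (Spec_topology F) (ppi G F \<eta> -` U \<inter> topspace (Spec_topology F))"
  proof cases
    case 1
    then have "ppi G F \<eta> -` U \<inter> topspace (Spec_topology F) = topspace (Spec_topology F)"
      using ppi_PV by (auto simp: topspace_Spec)
    then show ?thesis by simp
  next
    case 2
    \<comment> \<open>The positive part of \<open>\<eta> a\<close> lies outside \<open>P\<close>
      exactly when the coset of \<open>\<eta> a\<close> is strictly above \<open>P\<close>, so the
      subbasic set pulls back to the open set of this one element.\<close>
    let ?x = "ojoin F (\<eta> a) \<one>\<^bsub>F\<^esub>"
    have x: "?x \<in> carrier F" using 2(1) by simp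
    have "ppi G F \<eta> P \<in> U \<longleftrightarrow> ?x \<notin> P" if P: "P \<in> Spec F" for P
    proof -
      interpret P: prime_in_l_group F P by (rule Spec_prime[OF P])
      have "ppi G F \<eta> P \<in> U \<longleftrightarrow> a \<in> ppi G F \<eta> P \<and> inv\<^bsub>G\<^esub> a \<notin> ppi G F \<eta> P"
        using ppi_PV[OF P] by (simp add: 2(2) PP_def)
      also have "\<dots> \<longleftrightarrow> P.below \<one>\<^bsub>F\<^esub> (\<eta> a) \<and> \<not> P.below (\<eta> a) \<one>\<^bsub>F\<^esub>"
        using below_one_eta_iff[OF P 2(1)] mem_ppi_iff[OF P, of a] 2(1) by simp
      also have "\<dots> \<longleftrightarrow> ?x \<notin> P"
        using P.positive_iff_ojoin_not_mem[of "\<eta> a"] P.below_total[of "\<eta> a" "\<one>\<^bsub>F\<^esub>"] 2(1) by auto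
      finally show ?thesis .
    qed
    then have "ppi G F \<eta> -` U \<inter> topspace (Spec_topology F) = SS F {?x}"
      unfolding topspace_Spec SS_def by blast
    then show ?thesis unfolding F.openin_Spec_topology using x by blast
  qed
qed

lemma homeomorphic_kappa_ppi:
  "homeomorphic_maps (PV_topology V G) (Spec_topology F) (kappa G F \<eta>) (ppi G F \<eta>)"
  unfolding homeomorphic_maps_def topspace_PV topspace_Spec
  using continuous_kappa continuous_ppi ppi_kappa kappa_ppi by blast

lemma homeomorphic_kappa_ppi_star:
  "homeomorphic_maps (BV_topology V G) (Spec_star_topology F) (kappa G F \<eta>) (ppi G F \<eta>)"
  unfolding BV_topology_def Spec_star_topology_def
  by (rule homeomorphic_maps_subtopologies_alt[OF homeomorphic_kappa_ppi])
    (use kappa_normal ppi_BV in blast)+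

end

text \<open>That the maps are mutually inverse is contained in \<open>homeomorphic_maps\<close>,
  since the underlying sets of the two spaces are \<open>PV V G\<close> and
  \<open>Spec F\<close>.\<close>

theorem theorem2p1:
  fixes G :: "'g ogroup" and F :: "'f ogroup" and \<eta> :: "'g \<Rightarrow> 'f" and V :: variety
  assumes "po_group G"
    and "free_l_group TYPE('f) V G F \<eta>"
    and "free_l_group TYPE('g set \<Rightarrow> 'g set) V G F \<eta>"
  shows "kappa G F \<eta> \<in> PV V G \<rightarrow> Spec F \<and>
    ppi G F \<eta> \<in> Spec F \<rightarrow> PV V G \<and>
    (\<forall>C\<in>PV V G. \<forall>D\<in>PV V G. C \<subseteq> D \<longrightarrow> kappa G F \<eta> C \<subseteq> kappa G F \<eta> D) \<and>
    (\<forall>P\<in>Spec F. \<forall>Q\<in>Spec F. P \<subseteq> Q \<longrightarrow> ppi G F \<eta> P \<subseteq> ppi G F \<eta> Q) \<and>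
    homeomorphic_maps (PV_topology V G) (Spec_topology F) (kappa G F \<eta>) (ppi G F \<eta>) \<and>
    homeomorphic_maps (BV_topology V G) (Spec_star_topology F) (kappa G F \<eta>) (ppi G F \<eta>)"
proof -
  interpret free_l_group_over G F \<eta> V
    by (intro free_l_group_over.intro free_l_group_over_axioms.intro assms)
  show ?thesis
    by (intro conjI ballI impI Pi_I kappa_prime(1) ppi_PV kappa_mono ppi_mono
        homeomorphic_kappa_ppi homeomorphic_kappa_ppi_star)
qed

end
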